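(* Let $K$ be an algebraically closed field of characteristic zero, let $R = K[x_1,x_2,x_3]$ with the standard grading, and let $I = (F_1,F_2,F_3) \subset R$ be an Artinian complete intersection ideal, i.e. $F_1,F_2,F_3$ is a regular sequence of homogeneous polynomials of positive degrees. Then $R/I$ has the Weak Lefschetz property.
   Context: A standard graded Artinian $K$-algebra $A = \bigoplus_{i\ge 0} A_i$ has the Weak Lefschetz property if there is an element $\ell \in A_1$ such that for every $i \ge 0$ the multiplication map $\times \ell : A_i \to A_{i+1}$ has maximal rank (i.e. is injective or surjective). *)

theory Defs
  imports
    "HOL-Library.Poly_Mapping"
    "HOL-Library.Numeral_Type"
    "HOL-Computational_Algebra.Polynomial"
    "HOL-Algebra.QuotRing"
    "HOL-Algebra.Algebraic_Closure_Type"
begin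

text \<open>
  A monomial is a finitely supported exponent vector, a polynomial a finitely supported
  family of coefficients indexed by monomials; its ring operations are those of the
  instance \<^typ>\<open>('v \<Rightarrow>\<^sub>0 nat) \<Rightarrow>\<^sub>0 'k::comm_ring_1\<close> of class \<^class>\<open>comm_ring_1\<close>.
\<close>

type_synonym ('v, 'k) mpoly = "('v \<Rightarrow>\<^sub>0 nat) \<Rightarrow>\<^sub>0 'k"

definition monom_deg :: "('v \<Rightarrow>\<^sub>0 nat) \<Rightarrow> nat" where
  "monom_deg m = (\<Sum>v\<in>Poly_Mapping.keys m. Poly_Mapping.lookup m v)"

text \<open>The zero polynomial is homogeneous of every degree.\<close>

definition homogeneous :: "nat \<Rightarrow> ('v, 'k::zero) mpoly \<Rightarrow> bool" where
  "homogeneous d p \<longleftrightarrow> (\<forall>m\<in>Poly_Mapping.keys p. monom_deg m = d)"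

abbreviation mpoly_ring :: "('v, 'k::comm_ring_1) mpoly ring" where
  "mpoly_ring \<equiv> ring_of_type_algebra"

text \<open>
  Each entry is a nonzerodivisor on the quotient by the ideal of its predecessors, and the
  quotient by all the entries is not the zero ring.
\<close>

definition regular_sequence :: "('a, 'b) ring_scheme \<Rightarrow> 'a list \<Rightarrow> bool" where
  "regular_sequence R fs \<longleftrightarrow>
     set fs \<subseteq> carrier R \<and>
     (\<forall>i<length fs.
        let J = Idl\<^bsub>R\<^esub> (set (take i fs)) in
        \<forall>a\<in>carrier (R Quot J).
          (J +>\<^bsub>R\<^esub> (fs ! i)) \<otimes>\<^bsub>R Quot J\<^esub> a = \<zero>\<^bsub>R Quot J\<^esub> \<longrightarrow> a = \<zero>\<^bsub>R Quot J\<^esub>) \<and>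
     Idl\<^bsub>R\<^esub> (set fs) \<noteq> carrier R"

text \<open>The degree \<open>i\<close> component of the quotient of the polynomial ring by a homogeneous ideal \<open>I\<close>.\<close>

definition quot_component ::
  "('v, 'k::comm_ring_1) mpoly set \<Rightarrow> nat \<Rightarrow> ('v, 'k) mpoly set set" where
  "quot_component I i = (\<lambda>p. I +>\<^bsub>mpoly_ring\<^esub> p) ` {p. homogeneous i p}"

text \<open>
  Here \<open>C i\<close> is the degree \<open>i\<close> component of the graded algebra \<open>A\<close>. Having maximal rank does
  not refer to scalars, so the algebra structure over the base field does not appear.
\<close>

definition weak_lefschetz :: "('a, 'b) ring_scheme \<Rightarrow> (nat \<Rightarrow> 'a set) \<Rightarrow> bool" where
  "weak_lefschetz A C \<longleftrightarrow>
     (\<exists>l\<in>C 1. \<forall>i.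
        inj_on (\<lambda>a. l \<otimes>\<^bsub>A\<^esub> a) (C i) \<or> (\<lambda>a. l \<otimes>\<^bsub>A\<^esub> a) ` C i = C (Suc i))"

end

theory Submission
  imports Defs
begin

text \<open>
  Set \<open>x = 1\<close> and restrict to a general line \<open>z = s + t y\<close>. Multiplication by
  \<open>l = z - s x - t y\<close> is injective in degree \<open>k\<close> if the restrictions \<open>f\<^sub>i\<close> of the \<open>F\<^sub>i\<close> have no
  nonzero syzygy of degree \<open>k + 1\<close>, and surjective if the \<open>f\<^sub>i\<close> span all binary forms of degree
  \<open>k + 1\<close>. If some \<open>d\<^sub>k \<ge> d\<^sub>i + d\<^sub>j - 1\<close>, both follow from the coprimality of \<open>f\<^sub>i\<close> and \<open>f\<^sub>j\<close>.
  Otherwise a dimension count reduces everything to showing that the general line carries no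
  nonzero syzygy of degree \<open>n\<close> for the largest \<open>n\<close> with \<open>2 n + 2 \<le> d\<^sub>1 + d\<^sub>2 + d\<^sub>3\<close>.

  This is the Grauert-Muelich theorem for the syzygy bundle, by the classical descent argument.
  If all lines carry such a syzygy, elimination gives one, \<open>g\<close>, depending polynomially on
  \<open>(s, t)\<close>. The derivation \<open>D\<close> that turns the line about a point kills the \<open>f\<^sub>i\<close>, so \<open>D g\<close> is a
  syzygy of degree \<open>n + 1\<close>. As \<open>n + (n + 1) < d\<^sub>1 + d\<^sub>2 + d\<^sub>3\<close>, the cross product of \<open>g\<close> and \<open>D g\<close>, a
  multiple of \<open>(f\<^sub>1, f\<^sub>2, f\<^sub>3)\<close>, vanishes for degree reasons. So the ratios of the \<open>g\<^sub>i\<close> are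
  constant under \<open>D\<close> and hence, in characteristic zero, functions of the point alone: \<open>g = q G\<close>
  with \<open>G\<close> a syzygy of the \<open>F\<^sub>i\<close> on the plane, of degree at most \<open>n\<close> by unique factorisation. But
  the syzygies of a regular sequence are the Koszul ones, of degree at least
  \<open>min (d\<^sub>i + d\<^sub>j) > n\<close>.
\<close>

section \<open>A copy of a field with gcds\<close>

text \<open>
  The library has gcds in polynomial rings only over the class \<open>field_gcd\<close>, to which an
  arbitrary field does not belong; the copy of a field declared here does.
\<close>

typedef 'a field_copy = "UNIV :: 'a set"
  morphisms of_copy to_copy ..

setup_lifting type_definition_field_copy

instantiation field_copy :: (field) field
begin
lift_definition zero_field_copy :: "'a field_copy" is 0 .
lift_definition one_field_copy :: "'a field_copy" is 1 .
lift_definition plus_field_copy :: "'a field_copy \<Rightarrow> 'a field_copy \<Rightarrow> 'a field_copy" is "(+)" .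
lift_definition minus_field_copy :: "'a field_copy \<Rightarrow> 'a field_copy \<Rightarrow> 'a field_copy" is "(-)" .
lift_definition uminus_field_copy :: "'a field_copy \<Rightarrow> 'a field_copy" is uminus .
lift_definition times_field_copy :: "'a field_copy \<Rightarrow> 'a field_copy \<Rightarrow> 'a field_copy" is "(*)" .
lift_definition divide_field_copy :: "'a field_copy \<Rightarrow> 'a field_copy \<Rightarrow> 'a field_copy" is "(/)" .
lift_definition inverse_field_copy :: "'a field_copy \<Rightarrow> 'a field_copy" is inverse .
instance
  by standard (transfer; simp add: algebra_simps field_class.field_divide_inverse)+
end

instance field_copy :: (field_char_0) field_char_0
proof
  have of_nat_copy: "of_copy (of_nat n :: 'a field_copy) = of_nat n" for n
    by (induction n) (simp_all add: zero_field_copy.rep_eq one_field_copy.rep_eq plus_field_copy.rep_eq)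
  show "inj (of_nat :: nat \<Rightarrow> 'a field_copy)"
    by (rule injI) (metis of_nat_copy of_nat_eq_iff)
qed

instantiation field_copy ::
  (field) "{unique_euclidean_ring, normalization_euclidean_semiring, normalization_semidom_multiplicative}"
begin

definition [simp]: "normalize_field_copy = (normalize_field :: 'a field_copy \<Rightarrow> _)"
definition [simp]: "unit_factor_field_copy = (unit_factor_field :: 'a field_copy \<Rightarrow> _)"
definition [simp]: "modulo_field_copy = (mod_field :: 'a field_copy \<Rightarrow> _)"
definition [simp]: "euclidean_size_field_copy = (euclidean_size_field :: 'a field_copy \<Rightarrow> _)"
definition [simp]: "division_segment (x :: 'a field_copy) = 1"

instance
  by standard
    (simp_all add: dvd_field_iff field_split_simps split: if_splits)

end

instantiation field_copy :: (field) euclidean_ring_gcd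
begin

definition gcd_field_copy :: "'a field_copy \<Rightarrow> 'a field_copy \<Rightarrow> 'a field_copy" where
  "gcd_field_copy = Euclidean_Algorithm.gcd"
definition lcm_field_copy :: "'a field_copy \<Rightarrow> 'a field_copy \<Rightarrow> 'a field_copy" where
  "lcm_field_copy = Euclidean_Algorithm.lcm"
definition Gcd_field_copy :: "'a field_copy set \<Rightarrow> 'a field_copy" where
  "Gcd_field_copy = Euclidean_Algorithm.Gcd"
definition Lcm_field_copy :: "'a field_copy set \<Rightarrow> 'a field_copy" where
  "Lcm_field_copy = Euclidean_Algorithm.Lcm"

instance
  by standard (simp_all add: gcd_field_copy_def lcm_field_copy_def Gcd_field_copy_def Lcm_field_copy_def)

end

instance field_copy :: (field) field_gcd ..


section \<open>Linear systems over integral domains\<close>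

definition ring_hom_type :: "('a::comm_ring_1 \<Rightarrow> 'b::comm_ring_1) \<Rightarrow> bool" where
  "ring_hom_type h \<longleftrightarrow>
     h 0 = 0 \<and> h 1 = 1 \<and> (\<forall>x y. h (x + y) = h x + h y) \<and> (\<forall>x y. h (x * y) = h x * h y)"

lemma ring_hom_typeD:
  assumes "ring_hom_type h"
  shows "h 0 = 0" "h 1 = 1" "h (x + y) = h x + h y" "h (x * y) = h x * h y"
  using assms unfolding ring_hom_type_def by blast+

lemma ring_hom_type_minus:
  assumes "ring_hom_type h"
  shows "h (- x) = - h x" "h (x - y) = h x - h y"
proof -
  show *: "h (- x) = - h x" for x
    by (metis add.right_inverse add_eq_0_iff assms ring_hom_typeD(1,3))
  show "h (x - y) = h x - h y"
    using ring_hom_typeD(3)[OF assms, of x "- y"] * by simp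
qed

lemma ring_hom_type_sum: "ring_hom_type h \<Longrightarrow> h (\<Sum>i\<in>S. f i) = (\<Sum>i\<in>S. h (f i))"
  by (induction S rule: infinite_finite_induct) (auto simp: ring_hom_typeD)

text \<open>Elimination of the unknown \<open>j0\<close> without division: once the other unknowns
  are scaled by the pivot \<open>M p j0\<close>, row \<open>p\<close> can be solved for
  \<open>j0\<close>, and substitution turns row \<open>i\<close> into its two-by-two minors with row
  \<open>p\<close>.\<close>

lemma elimination_pivot:
  fixes M :: "'r \<Rightarrow> 'c \<Rightarrow> 'a::comm_ring_1"
  assumes "finite T" "j0 \<notin> T"
  shows "(\<Sum>j\<in>insert j0 T. M i j * (if j = j0 then - (\<Sum>j\<in>T. M p j * v j) else M p j0 * v j))
       = (\<Sum>j\<in>T. (M p j0 * M i j - M i j0 * M p j) * v j)"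
proof -
  have "(\<Sum>j\<in>T. M i j * (if j = j0 then - (\<Sum>j\<in>T. M p j * v j) else M p j0 * v j))
      = (\<Sum>j\<in>T. M i j * (M p j0 * v j))"
    using assms by (intro sum.cong) auto
  with assms show ?thesis
    by (simp add: algebra_simps sum_subtractf sum_distrib_left)
qed

text \<open>Division-free Gaussian elimination, one unknown at a time. Either some reduced matrix
  has a zero column and a kernel vector appears, or every unknown gets a pivot, and \<delta> is the
  product of the pivots. A homomorphism that does not kill \<delta> keeps all pivots nonzero, so the
  specialised system has trivial kernel for the same reason.\<close>

lemma elimination:
  fixes M :: "'r \<Rightarrow> 'c \<Rightarrow> 'a::idom"
  assumes "finite T"
  shows "(\<exists>v. (\<exists>j\<in>T. v j \<noteq> 0) \<and> (\<forall>i\<in>S. (\<Sum>j\<in>T. M i j * v j) = 0)) \<or>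
     (\<exists>\<delta>. \<delta> \<noteq> 0 \<and> (\<forall>\<psi>::'a \<Rightarrow> 'b::idom. ring_hom_type \<psi> \<longrightarrow> \<psi> \<delta> \<noteq> 0 \<longrightarrow>
        (\<forall>v. (\<forall>i\<in>S. (\<Sum>j\<in>T. \<psi> (M i j) * v j) = 0) \<longrightarrow> (\<forall>j\<in>T. v j = 0))))"
  using assms
proof (induction T arbitrary: M rule: finite_induct)
  case empty
  have "(1::'a) \<noteq> 0" by simp
  then show ?case by blast
next
  case (insert j0 T)
  show ?case
  proof (cases "\<exists>p\<in>S. M p j0 \<noteq> 0")
    case False
    have "(\<exists>j\<in>insert j0 T. (if j = j0 then 1 else 0 :: 'a) \<noteq> 0)" by auto
    moreover have "\<forall>i\<in>S. (\<Sum>j\<in>insert j0 T. M i j * (if j = j0 then 1 else 0)) = 0"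
      using False insert.hyps by (auto simp: sum.If_cases intro!: sum.neutral)
    ultimately show ?thesis by (intro disjI1 exI[of _ "\<lambda>j. if j = j0 then 1 else 0"]) blast
  next
    case True
    then obtain p where p: "p \<in> S" "M p j0 \<noteq> 0" by blast
    define M' where "M' i j = M p j0 * M i j - M i j0 * M p j" for i j
    from insert.IH[of M'] show ?thesis
    proof (elim disjE exE conjE)
      fix v assume v: "\<exists>j\<in>T. v j \<noteq> 0" "\<forall>i\<in>S. (\<Sum>j\<in>T. M' i j * v j) = 0"
      define w where "w j = (if j = j0 then - (\<Sum>j\<in>T. M p j * v j) else M p j0 * v j)" for j
      have "\<exists>j\<in>insert j0 T. w j \<noteq> 0"
        using v(1) p(2) insert.hyps unfolding w_def by fastforce
      moreover have "\<forall>i\<in>S. (\<Sum>j\<in>insert j0 T. M i j * w j) = 0"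
        unfolding w_def using elimination_pivot[OF insert.hyps, of M _ p v] v(2) M'_def by simp
      ultimately show ?thesis by blast
    next
      fix \<delta> :: 'a
      assume \<delta>: "\<delta> \<noteq> 0" "\<forall>\<psi>::'a \<Rightarrow> 'b. ring_hom_type \<psi> \<longrightarrow> \<psi> \<delta> \<noteq> 0 \<longrightarrow>
        (\<forall>v. (\<forall>i\<in>S. (\<Sum>j\<in>T. \<psi> (M' i j) * v j) = 0) \<longrightarrow> (\<forall>j\<in>T. v j = 0))"
      have "\<forall>j\<in>insert j0 T. v j = 0"
        if \<psi>: "ring_hom_type \<psi>" "\<psi> (M p j0 * \<delta>) \<noteq> 0"
          and v: "\<forall>i\<in>S. (\<Sum>j\<in>insert j0 T. \<psi> (M i j) * v j) = 0"
        for \<psi> :: "'a \<Rightarrow> 'b" and v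
      proof -
        note hom = ring_hom_typeD[OF \<psi>(1)] ring_hom_type_minus[OF \<psi>(1)]
        have nz: "\<psi> (M p j0) \<noteq> 0" "\<psi> \<delta> \<noteq> 0" using \<psi>(2) by (auto simp: hom)
        have row: "(\<Sum>j\<in>T. \<psi> (M i j) * v j) = - \<psi> (M i j0) * v j0" if "i \<in> S" for i
          using v that insert.hyps by (auto simp: add_eq_0_iff)
        have "(\<Sum>j\<in>T. \<psi> (M' i j) * v j) = 0" if "i \<in> S" for i
        proof -
          have "(\<Sum>j\<in>T. \<psi> (M' i j) * v j)
             = \<psi> (M p j0) * (\<Sum>j\<in>T. \<psi> (M i j) * v j) - \<psi> (M i j0) * (\<Sum>j\<in>T. \<psi> (M p j) * v j)"
            by (simp add: M'_def hom algebra_simps sum_subtractf sum_distrib_left)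
          also have "\<dots> = 0"
            using that p(1) by (simp add: row)
          finally show ?thesis .
        qed
        then have T0: "\<forall>j\<in>T. v j = 0" using \<delta>(2) \<psi>(1) nz(2) by blast
        then have "\<psi> (M p j0) * v j0 = 0" using row[OF p(1)] by simp
        with nz(1) T0 show ?thesis by auto
      qed
      with \<delta>(1) p(2) show ?thesis by (intro disjI2 exI[of _ "M p j0 * \<delta>"]) auto
    qed
  qed
qed

text \<open>Induction on the equations: a trivial equation is dropped, and any other is used up by a
  pivot step together with one unknown, so the strict inequality of the cardinalities
  survives.\<close>

lemma underdetermined_system:
  fixes M :: "'r \<Rightarrow> 'c \<Rightarrow> 'a::idom"
  assumes "finite S" "finite T" "card S < card T"
  shows "\<exists>v. (\<exists>j\<in>T. v j \<noteq> 0) \<and> (\<forall>i\<in>S. (\<Sum>j\<in>T. M i j * v j) = 0)"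
  using assms
proof (induction S arbitrary: M T rule: finite_induct)
  case empty
  then obtain j where "j \<in> T" by fastforce
  then show ?case by (intro exI[of _ "\<lambda>_. 1"]) auto
next
  case (insert p S)
  show ?case
  proof (cases "\<exists>j\<in>T. M p j \<noteq> 0")
    case False
    with insert.IH[of T M] insert.prems insert.hyps show ?thesis by fastforce
  next
    case True
    then obtain j0 where j0: "j0 \<in> T" "M p j0 \<noteq> 0" by blast
    define U where "U = T - {j0}"
    have U: "finite U" "j0 \<notin> U" "T = insert j0 U" "card S < card U"
      using insert.prems insert.hyps j0 by (auto simp: U_def)
    from insert.IH[OF U(1,4), of "\<lambda>i j. M p j0 * M i j - M i j0 * M p j"] obtain v where
      v: "\<exists>j\<in>U. v j \<noteq> 0" "\<forall>i\<in>S. (\<Sum>j\<in>U. (M p j0 * M i j - M i j0 * M p j) * v j) = 0" by blast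
    define w where "w j = (if j = j0 then - (\<Sum>j\<in>U. M p j * v j) else M p j0 * v j)" for j
    have "\<exists>j\<in>T. w j \<noteq> 0"
      using v(1) j0(2) U(2,3) unfolding w_def by fastforce
    moreover have "\<forall>i\<in>insert p S. (\<Sum>j\<in>T. M i j * w j) = 0"
      unfolding w_def U(3) using elimination_pivot[OF U(1,2), of M _ p v] v(2) by (auto simp: algebra_simps)
    ultimately show ?thesis by blast
  qed
qed

section \<open>Degree bounds\<close>

text \<open>
  Bounds are integers: a negative bound forces the polynomial to vanish, so that no truncated
  subtraction appears in expressions such as the degree of a cofactor.
\<close>

definition deg_le :: "int \<Rightarrow> 'a::zero poly \<Rightarrow> bool" where
  "deg_le b p \<longleftrightarrow> (\<forall>k. coeff p k \<noteq> 0 \<longrightarrow> int k \<le> b)"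

definition tdeg_le :: "int \<Rightarrow> 'a::zero poly poly \<Rightarrow> bool" where
  "tdeg_le b r \<longleftrightarrow> (\<forall>i. deg_le (b - int i) (coeff r i))"

lemma deg_leD: "deg_le b p \<Longrightarrow> b < int k \<Longrightarrow> coeff p k = 0"
  unfolding deg_le_def by force

lemma deg_le_0 [simp]: "deg_le b 0"
  by (simp add: deg_le_def)

lemma deg_le_degree: "deg_le b p \<longleftrightarrow> p = 0 \<or> int (degree p) \<le> b"
  unfolding deg_le_def
  by (metis coeff_0 leading_coeff_0_iff le_degree of_nat_le_iff order_trans)

lemma deg_le_neg: "deg_le b p \<Longrightarrow> b < 0 \<Longrightarrow> p = 0"
  by (auto simp: deg_le_degree)

lemma deg_le_mono: "deg_le b p \<Longrightarrow> b \<le> c \<Longrightarrow> deg_le c p"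
  unfolding deg_le_def by force

lemma deg_le_add: "deg_le b p \<Longrightarrow> deg_le b q \<Longrightarrow> deg_le b (p + q)"
  unfolding deg_le_def by (metis add_0 coeff_add)

lemma deg_le_uminus: "deg_le b (p :: 'a::comm_ring_1 poly) \<Longrightarrow> deg_le b (- p)"
  by (simp add: deg_le_degree)

lemma deg_le_diff: "deg_le b p \<Longrightarrow> deg_le b q \<Longrightarrow> deg_le b (p - q :: 'a::comm_ring_1 poly)"
  using deg_le_add[of b p "- q"] deg_le_uminus by auto

lemma deg_le_mult:
  "deg_le b p \<Longrightarrow> deg_le c q \<Longrightarrow> deg_le (b + c) (p * q :: 'a::comm_ring_1 poly)"
  using degree_mult_le[of p q] by (auto simp: deg_le_degree)

lemma deg_le_sum: "(\<And>i. i \<in> S \<Longrightarrow> deg_le b (f i)) \<Longrightarrow> deg_le b (\<Sum>i\<in>S. f i)"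
  by (induction S rule: infinite_finite_induct) (auto intro: deg_le_add)

lemma deg_le_pCons: "deg_le b (pCons a p) \<longleftrightarrow> (a = 0 \<or> 0 \<le> b) \<and> deg_le (b - 1) p"
proof -
  have "deg_le b (pCons a p) \<longleftrightarrow> (\<forall>k. coeff (pCons a p) k \<noteq> 0 \<longrightarrow> int k \<le> b)"
    by (simp add: deg_le_def)
  also have "\<dots> \<longleftrightarrow> (a \<noteq> 0 \<longrightarrow> 0 \<le> b) \<and> (\<forall>k. coeff p k \<noteq> 0 \<longrightarrow> int (Suc k) \<le> b)"
    by (metis coeff_pCons_0 coeff_pCons_Suc nat.exhaust of_nat_0)
  finally show ?thesis unfolding deg_le_def by force
qed

lemma deg_le_mult_cancel:
  fixes p q :: "'a::idom poly"
  assumes "deg_le b (p * q)" "p \<noteq> 0"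
  shows "deg_le b q"
  using assms by (cases "q = 0") (auto simp: deg_le_degree degree_mult_eq)

lemma tdeg_le_0 [simp]: "tdeg_le b 0"
  by (simp add: tdeg_le_def)

lemma tdeg_leD: "tdeg_le b r \<Longrightarrow> b < int i + int j \<Longrightarrow> coeff (coeff r i) j = 0"
  unfolding tdeg_le_def by (auto intro: deg_leD)

lemma tdeg_leI: "(\<And>i j. coeff (coeff r i) j \<noteq> 0 \<Longrightarrow> int i + int j \<le> b) \<Longrightarrow> tdeg_le b r"
  unfolding tdeg_le_def deg_le_def by force

lemma tdeg_le_neg: "tdeg_le b r \<Longrightarrow> b < 0 \<Longrightarrow> r = 0"
  by (intro poly_eqI) (simp add: tdeg_leD)

lemma tdeg_le_mono: "tdeg_le b p \<Longrightarrow> b \<le> c \<Longrightarrow> tdeg_le c p"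
  unfolding tdeg_le_def by (meson deg_le_mono diff_right_mono)

lemma tdeg_le_add: "tdeg_le b p \<Longrightarrow> tdeg_le b q \<Longrightarrow> tdeg_le b (p + q)"
  unfolding tdeg_le_def by (auto intro: deg_le_add)

lemma tdeg_le_uminus: "tdeg_le b (p :: 'a::comm_ring_1 poly poly) \<Longrightarrow> tdeg_le b (- p)"
  unfolding tdeg_le_def by (auto intro: deg_le_uminus)

lemma tdeg_le_diff: "tdeg_le b p \<Longrightarrow> tdeg_le b q \<Longrightarrow> tdeg_le b (p - q :: 'a::comm_ring_1 poly poly)"
  unfolding tdeg_le_def by (auto intro: deg_le_diff)

lemma tdeg_le_mult:
  assumes "tdeg_le b p" "tdeg_le c q"
  shows "tdeg_le (b + c) (p * q :: 'a::comm_ring_1 poly poly)"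
  unfolding tdeg_le_def coeff_mult
proof (intro allI deg_le_sum)
  fix n i :: nat assume "i \<in> {..n}"
  have "deg_le (b - int i + (c - int (n - i))) (coeff p i * coeff q (n - i))"
    using assms unfolding tdeg_le_def by (intro deg_le_mult) auto
  with \<open>i \<in> {..n}\<close> show "deg_le (b + c - int n) (coeff p i * coeff q (n - i))"
    by (simp add: of_nat_diff algebra_simps)
qed

lemma tdeg_le_pCons: "tdeg_le b (pCons a r) \<longleftrightarrow> deg_le b a \<and> tdeg_le (b - 1) r"
proof -
  have "tdeg_le b (pCons a r) \<longleftrightarrow>
      deg_le b a \<and> (\<forall>i. deg_le (b - int (Suc i)) (coeff r i))"
    unfolding tdeg_le_def
    by (metis coeff_pCons_0 coeff_pCons_Suc diff_zero nat.exhaust of_nat_0)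
  then show ?thesis by (simp add: tdeg_le_def algebra_simps)
qed

lemma tdeg_le_const: "deg_le b a \<Longrightarrow> tdeg_le b [:a:]"
  by (simp add: tdeg_le_pCons)

lemma tdeg_le_exists: "\<exists>n::nat. tdeg_le (int n) r"
proof (induction r)
  case 0
  then show ?case by simp
next
  case (pCons a r)
  then obtain n where n: "tdeg_le (int n) r" by blast
  have "tdeg_le (int (max (Suc n) (degree a))) (pCons a r)"
    unfolding tdeg_le_pCons
    by (auto simp: deg_le_degree intro: tdeg_le_mono[OF n])
  then show ?case by blast
qed

section \<open>Families of polynomials on lines\<close>

definition ev_hom :: "('a::comm_ring_1 \<Rightarrow> 'b::comm_ring_1) \<Rightarrow> 'b \<Rightarrow> 'a poly \<Rightarrow> 'b" where
  "ev_hom h x p = poly (map_poly h p) x"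

lemma ev_hom_pCons: "h 0 = 0 \<Longrightarrow> ev_hom h x (pCons a p) = h a + x * ev_hom h x p"
  by (simp add: ev_hom_def map_poly_pCons)

lemma ev_hom_0 [simp]: "ev_hom h x 0 = 0"
  by (simp add: ev_hom_def)

lemma ev_hom_var: "ring_hom_type h \<Longrightarrow> ev_hom h x [:0, 1:] = x"
  by (simp add: ev_hom_pCons ring_hom_typeD)

lemma ev_hom_const: "ring_hom_type h \<Longrightarrow> ev_hom h x [:a:] = h a"
  by (simp add: ev_hom_pCons ring_hom_typeD)

lemma ring_hom_ev_hom:
  assumes h: "ring_hom_type h"
  shows "ring_hom_type (ev_hom h x)"
proof -
  note hom = ring_hom_typeD[OF h]
  have add: "ev_hom h x (p + q) = ev_hom h x p + ev_hom h x q" for p q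
    by (induction p q rule: poly_induct2) (simp_all add: ev_hom_pCons hom algebra_simps)
  have smult: "ev_hom h x (smult a q) = h a * ev_hom h x q" for a q
    by (induction q) (simp_all add: ev_hom_pCons hom algebra_simps)
  have "ev_hom h x (p * q) = ev_hom h x p * ev_hom h x q" for p q
    by (induction p) (simp_all add: ev_hom_pCons hom add smult algebra_simps)
  then show ?thesis
    unfolding ring_hom_type_def by (simp add: add one_pCons ev_hom_pCons hom)
qed

lemma ring_hom_poly_ext:
  assumes "ring_hom_type h" "ring_hom_type h'"
    and "\<And>a. h [:a:] = h' [:a:]" "h [:0, 1:] = h' [:0, 1:]"
  shows "h p = h' p"
proof (induction p)
  case 0
  then show ?case using assms by (simp add: ring_hom_typeD)
next
  case (pCons a p)
  have *: "pCons a p = [:a:] + [:0, 1:] * p" by simp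
  show ?case
    unfolding * ring_hom_typeD(3,4)[OF assms(1)] ring_hom_typeD(3,4)[OF assms(2)] assms(3,4) pCons.IH ..
qed

lemma ring_hom_compose:
  "ring_hom_type h \<Longrightarrow> ring_hom_type h' \<Longrightarrow> ring_hom_type (\<lambda>x. h (h' x))"
  unfolding ring_hom_type_def by simp

lemma ring_hom_const: "ring_hom_type (\<lambda>x. [:x:])"
  unfolding ring_hom_type_def by (simp add: one_pCons)

lemma ring_hom_id: "ring_hom_type (\<lambda>x. x)"
  unfolding ring_hom_type_def by simp

lemma ring_hom_map_poly:
  assumes h: "ring_hom_type h"
  shows "ring_hom_type (map_poly h)"
proof -
  have "map_poly h = ev_hom (\<lambda>a. [:h a:]) [:0, 1:]"
  proof
    show "map_poly h p = ev_hom (\<lambda>a. [:h a:]) [:0, 1:] p" for p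
      by (induction p) (simp_all add: ev_hom_pCons map_poly_pCons ring_hom_typeD[OF h])
  qed
  moreover have "ring_hom_type (ev_hom (\<lambda>a. [:h a:]) [:0, 1:])"
    by (rule ring_hom_ev_hom[OF ring_hom_compose[OF ring_hom_const h]])
  ultimately show ?thesis by simp
qed

definition const3 :: "'k::comm_ring_1 \<Rightarrow> 'k poly poly poly" where
  "const3 a = [:[:[:a:]:]:]"

text \<open>The variables are named by nesting level because each level has two meanings: inner,
  middle and outer are \<open>s\<close>, \<open>t\<close>, \<open>y\<close> in line coordinates and
  \<open>y\<close>, \<open>z\<close>, \<open>t\<close> in point coordinates.\<close>

definition var_in :: "'k::comm_ring_1 poly poly poly" where "var_in = [:[:[:0, 1:]:]:]"
definition var_mid :: "'k::comm_ring_1 poly poly poly" where "var_mid = [:[:0, 1:]:]"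
definition var_out :: "'k::comm_ring_1 poly poly poly" where "var_out = [:0, 1:]"

definition ev3 :: "'k::comm_ring_1 poly poly poly \<Rightarrow> 'k poly poly poly \<Rightarrow> 'k poly poly poly \<Rightarrow>
    'k poly poly poly \<Rightarrow> 'k poly poly poly" where
  "ev3 a b c = ev_hom (ev_hom (ev_hom const3 a) b) c"

lemma ring_hom_const3: "ring_hom_type const3"
  unfolding ring_hom_type_def by (simp add: const3_def one_pCons)

lemma ring_hom_ev3: "ring_hom_type (ev3 a b c)"
  unfolding ev3_def by (intro ring_hom_ev_hom ring_hom_const3)

lemma ev3_simps:
  "ev3 a b c (const3 x) = const3 x" "ev3 a b c var_in = a" "ev3 a b c var_mid = b"
  "ev3 a b c var_out = c"
  unfolding ev3_def var_in_def var_mid_def var_out_def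
  by (simp_all add: const3_def ev_hom_var ev_hom_const ring_hom_const3 ring_hom_ev_hom)

lemma ring_hom_poly3_ext:
  assumes h: "ring_hom_type h" "ring_hom_type h'"
    and "\<And>a. h (const3 a) = h' (const3 a)"
    and "h var_in = h' var_in" "h var_mid = h' var_mid" "h var_out = h' var_out"
  shows "h p = h' p"
proof (rule ring_hom_poly_ext[OF h])
  fix q
  have h1: "ring_hom_type (\<lambda>x. h [:x:])" "ring_hom_type (\<lambda>x. h' [:x:])"
    using ring_hom_compose[OF h(1) ring_hom_const] ring_hom_compose[OF h(2) ring_hom_const] .
  show "h [:q:] = h' [:q:]"
  proof (rule ring_hom_poly_ext[OF h1])
    fix r
    have h2: "ring_hom_type (\<lambda>x. h [:[:x:]:])" "ring_hom_type (\<lambda>x. h' [:[:x:]:])"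
      using ring_hom_compose[OF h1(1) ring_hom_const] ring_hom_compose[OF h1(2) ring_hom_const] .
    show "h [:[:r:]:] = h' [:[:r:]:]"
      by (rule ring_hom_poly_ext[OF h2, of r]) (use assms(3,4) in \<open>simp_all add: const3_def var_in_def\<close>)
  qed (use assms(5) in \<open>simp add: var_mid_def\<close>)
qed (use assms(6) in \<open>simp add: var_out_def\<close>)

text \<open>
  The lines \<open>z = s + t y\<close>. In \<open>line coordinates\<close> an element of \<open>K[s][t][y]\<close> is a polynomial
  function of a line and of a point on it; in \<open>point coordinates\<close>, i.e. in \<open>K[y][z][t]\<close>, it is a
  function of a point \<open>(y, z)\<close> and of a line through it with slope \<open>t\<close>.
\<close>

definition to_point :: "'k::comm_ring_1 poly poly poly \<Rightarrow> 'k poly poly poly" where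
  "to_point = ev3 (var_mid - var_out * var_in) var_out var_in"

definition to_line :: "'k::comm_ring_1 poly poly poly \<Rightarrow> 'k poly poly poly" where
  "to_line = ev3 var_out (var_in + var_mid * var_out) var_mid"

lemma ring_hom_to_point: "ring_hom_type to_point"
  and ring_hom_to_line: "ring_hom_type to_line"
  by (simp_all add: to_point_def to_line_def ring_hom_ev3)

lemmas to_point_hom = ring_hom_typeD[OF ring_hom_to_point] ring_hom_type_minus[OF ring_hom_to_point]
lemmas to_line_hom = ring_hom_typeD[OF ring_hom_to_line] ring_hom_type_minus[OF ring_hom_to_line]

lemma to_line_to_point [simp]: "to_line (to_point p) = p"
  by (rule ring_hom_poly3_ext[OF ring_hom_compose[OF ring_hom_to_line ring_hom_to_point] ring_hom_id])
     (simp_all add: to_point_def ev3_simps to_line_hom, simp_all add: to_line_def ev3_simps)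

lemma to_point_to_line [simp]: "to_point (to_line p) = p"
  by (rule ring_hom_poly3_ext[OF ring_hom_compose[OF ring_hom_to_point ring_hom_to_line] ring_hom_id])
     (simp_all add: to_line_def ev3_simps to_point_hom, simp_all add: to_point_def ev3_simps)

text \<open>In line coordinates this is \<open>\<partial>\<^sub>t - y \<partial>\<^sub>s\<close>: it varies the line through a fixed point.\<close>

definition line_deriv :: "'k::idom poly poly poly \<Rightarrow> 'k poly poly poly" where
  "line_deriv p = to_line (pderiv (to_point p))"

text \<open>A polynomial in \<open>y\<close> and \<open>z\<close> depends on the point alone, so in
  point coordinates it is constant in \<open>t\<close>. Passing to line coordinates gives
  \<open>r(y, s + t y)\<close>, the restrictions of \<open>r\<close> to all lines at once.\<close>

definition family :: "'k::comm_ring_1 poly poly \<Rightarrow> 'k poly poly poly" where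
  "family r = to_line [:r:]"

lemma ring_hom_family: "ring_hom_type family"
  using ring_hom_compose[OF ring_hom_to_line ring_hom_const] unfolding family_def .

lemma line_deriv_add: "line_deriv (p + q) = line_deriv p + line_deriv q"
  by (simp add: line_deriv_def to_point_hom to_line_hom pderiv_add)

lemma line_deriv_mult: "line_deriv (p * q) = p * line_deriv q + q * line_deriv p"
  by (simp add: line_deriv_def to_point_hom to_line_hom pderiv_mult)

lemma line_deriv_0 [simp]: "line_deriv 0 = 0"
  by (simp add: line_deriv_def to_point_hom to_line_hom)

lemma line_deriv_sum: "line_deriv (\<Sum>i\<in>S. f i) = (\<Sum>i\<in>S. line_deriv (f i))"
  by (induction S rule: infinite_finite_induct) (simp_all add: line_deriv_add)

lemma line_deriv_family [simp]: "line_deriv (family r) = 0"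
  by (simp add: line_deriv_def family_def pderiv_pCons to_line_hom)

lemma pderiv_vars:
  "pderiv (const3 a) = 0" "pderiv var_in = 0" "pderiv var_mid = 0" "pderiv var_out = 1"
  by (simp_all add: const3_def var_in_def var_mid_def var_out_def pderiv_pCons one_pCons)

lemma line_deriv_vars:
  "line_deriv (const3 a) = 0" "line_deriv var_in = - var_out" "line_deriv var_mid = 1"
  "line_deriv var_out = 0"
  by (simp_all add: line_deriv_def to_point_def ev3_simps pderiv_vars pderiv_diff pderiv_mult to_line_hom)
     (simp add: to_line_def ev3_simps)

section \<open>Degrees in \<open>y\<close> under the derivation and under restriction to
  lines\<close>

lemma deg_le_line_deriv_const: "deg_le 1 (line_deriv [:c:])"
proof (induction c)
  case 0
  then show ?case by simp
next
  case (pCons a c)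
  have a: "deg_le 1 (line_deriv [:[:a:]:])"
  proof (induction a)
    case 0
    then show ?case by simp
  next
    case (pCons k a)
    have "[:[:pCons k a:]:] = const3 k + var_in * [:[:a:]:]"
      by (simp add: const3_def var_in_def)
    then have *: "line_deriv [:[:pCons k a:]:] = var_in * line_deriv [:[:a:]:] - var_out * [:[:a:]:]"
      by (simp only: line_deriv_add line_deriv_mult line_deriv_vars) simp
    moreover have "deg_le (0 + 1) (var_in * line_deriv [:[:a:]:])"
      using pCons(2) by (intro deg_le_mult) (simp_all add: var_in_def deg_le_pCons)
    moreover have "deg_le 1 (var_out * [:[:a:]:])"
      by (simp add: var_out_def deg_le_pCons)
    ultimately show ?case by (simp add: deg_le_diff)
  qed
  have "[:pCons a c:] = [:[:a:]:] + var_mid * [:c:]"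
    by (simp add: var_mid_def)
  then have *: "line_deriv [:pCons a c:] = line_deriv [:[:a:]:] + (var_mid * line_deriv [:c:] + [:c:])"
    by (simp only: line_deriv_add line_deriv_mult line_deriv_vars) simp
  have "deg_le (0 + 1) (var_mid * line_deriv [:c:])"
    using pCons(2) by (intro deg_le_mult) (simp_all add: var_mid_def deg_le_pCons)
  moreover have "deg_le 1 [:c:]" by (simp add: deg_le_pCons)
  ultimately show ?case unfolding * using a by (intro deg_le_add) simp_all
qed

text \<open>The derivation kills \<open>y\<close> and acts on the coefficients, where only the term
  \<open>- y \<partial>\<^sub>s\<close> brings in a factor \<open>y\<close>, and brings in just
  one.\<close>

lemma deg_le_line_deriv: "deg_le b p \<Longrightarrow> deg_le (b + 1) (line_deriv p)"
proof (induction p arbitrary: b)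
  case 0
  then show ?case by simp
next
  case (pCons c p)
  have "pCons c p = [:c:] + var_out * p" by (simp add: var_out_def)
  then have "line_deriv (pCons c p) = line_deriv [:c:] + var_out * line_deriv p"
    by (simp only: line_deriv_add line_deriv_mult line_deriv_vars) simp
  moreover have "deg_le (b + 1) (line_deriv [:c:])"
  proof (cases "c = 0")
    case False
    with pCons.prems have "0 \<le> b" by (simp add: deg_le_pCons)
    then show ?thesis by (intro deg_le_mono[OF deg_le_line_deriv_const]) simp
  qed simp
  moreover have "deg_le (b + 1) (var_out * line_deriv p)"
    using pCons.IH[of "b - 1"] pCons.prems by (simp add: var_out_def deg_le_pCons)
  ultimately show ?case by (simp add: deg_le_add)
qed

lemma family_pCons: "family (pCons a r) = family [:a:] + (var_in + var_mid * var_out) * family r"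
proof -
  have *: "family [:0, 1:] = var_in + var_mid * var_out"
    by (simp add: family_def to_line_def ev3_simps flip: var_mid_def)
  have "pCons a r = [:a:] + [:0, 1:] * r" by simp
  then have "family (pCons a r) = family [:a:] + family [:0, 1:] * family r"
    by (metis ring_hom_typeD(3,4)[OF ring_hom_family])
  then show ?thesis unfolding * .
qed

lemma family_const: "family [:a:] = map_poly (\<lambda>x. [:[:x:]:]) a"
proof -
  have h: "ring_hom_type (\<lambda>x. family [:x:])"
    using ring_hom_compose[OF ring_hom_family ring_hom_const] .
  have h': "ring_hom_type (map_poly (\<lambda>x::'a. [:[:x:]:]))"
    by (rule ring_hom_map_poly[OF ring_hom_compose[OF ring_hom_const ring_hom_const]])
  have "family [:[:x:]:] = const3 x" for x :: 'a
    unfolding family_def to_line_def const3_def[symmetric] ev3_simps ..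
  note c = this
  have v: "family [:[:0, 1:]:] = (var_out :: 'a poly poly poly)"
    unfolding family_def to_line_def var_in_def[symmetric] ev3_simps ..
  show ?thesis
    by (rule ring_hom_poly_ext[OF h h', of a])
       (simp_all only: c v, simp_all add: map_poly_pCons const3_def var_out_def one_pCons)
qed

lemma coeff_family_const: "coeff (family [:a:]) n = [:[:coeff a n:]:]"
  by (simp add: family_const coeff_map_poly)

lemma deg_le_family: "tdeg_le b r \<Longrightarrow> deg_le b (family r)"
proof (induction r arbitrary: b)
  case 0
  then show ?case by (simp add: ring_hom_typeD[OF ring_hom_family])
next
  case (pCons a r)
  have "deg_le b (family [:a:])"
    using pCons.prems by (simp add: tdeg_le_pCons deg_le_def coeff_family_const)
  moreover have "deg_le (1 + (b - 1)) ((var_in + var_mid * var_out) * family r)"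
    using pCons.prems pCons.IH[of "b - 1"]
    by (intro deg_le_mult) (simp_all add: tdeg_le_pCons var_in_def var_mid_def var_out_def deg_le_pCons)
  ultimately show ?case unfolding family_pCons[of a r] by (simp add: deg_le_add)
qed

text \<open>Since \<open>(s + t y)^i\<close> has leading term \<open>t^i y^i\<close>, a monomial
  \<open>y^(n-i) z^i\<close> contributes exactly \<open>t^i\<close> to the coefficient of
  \<open>y^n\<close>. The form of degree \<open>n\<close> in \<open>r\<close> can therefore be read
  off from the family.\<close>

lemma coeff_family_top:
  "tdeg_le (int n) r \<Longrightarrow> i \<le> n \<Longrightarrow> coeff (coeff (family r) n) i = [:coeff (coeff r i) (n - i):]"
proof (induction r arbitrary: n i)
  case 0
  then show ?case by (simp add: ring_hom_typeD[OF ring_hom_family])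
next
  case (pCons a r)
  have r: "tdeg_le (int n - 1) r" using pCons.prems by (simp add: tdeg_le_pCons)
  \<comment> \<open>The Horner step multiplies \<open>family r\<close> by \<open>s + t y\<close>;
    for degree reasons the summand with \<open>s\<close> does not reach \<open>y^n\<close>.\<close>
  have "coeff (family r) n = 0"
    using deg_le_family[OF r] by (intro deg_leD) auto
  moreover have "(var_in + var_mid * var_out) * family r
      = smult [:[:0, 1:]:] (family r) + smult [:0, 1:] (pCons 0 (family r))"
    by (simp add: var_in_def var_mid_def var_out_def algebra_simps)
  ultimately have top: "coeff (family (pCons a r)) n
      = [:[:coeff a n:]:] + [:0, 1:] * coeff (pCons 0 (family r)) n"
    unfolding family_pCons[of a r]
    by (simp only: coeff_add coeff_smult coeff_family_const) simp
  show ?case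
  proof (cases n)
    case 0
    then show ?thesis using top pCons.prems by simp
  next
    case (Suc m)
    then have "tdeg_le (int m) r" using r by simp
    with pCons.IH[of m] top pCons.prems(2) Suc show ?thesis
      by (cases i) (simp_all)
  qed
qed

text \<open>No degree is lost on the general line: by \<open>coeff_family_top\<close> a nonzero form
  of top degree in \<open>r\<close> shows up in the family. Starting from any bound on
  \<open>r\<close>, the bound can thus be lowered one by one down to \<open>b\<close>.\<close>

lemma tdeg_le_of_family:
  assumes "deg_le b (family r)"
  shows "tdeg_le b r"
proof -
  have step: "tdeg_le (int n - 1) r" if "tdeg_le (int n) r" "deg_le (int n - 1) (family r)" for n
  proof (rule tdeg_leI)
    fix i j assume ij: "coeff (coeff r i) j \<noteq> 0"
    have "int i + int j \<le> int n"
      using ij tdeg_leD[OF that(1), of i j] by force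
    moreover have "i + j \<noteq> n"
    proof
      assume "i + j = n"
      moreover have "coeff (family r) n = 0" using that(2) by (rule deg_leD) simp
      ultimately show False using coeff_family_top[OF that(1), of i] ij by auto
    qed
    ultimately show "int i + int j \<le> int n - 1" by linarith
  qed
  \<comment> \<open>For negative \<open>b\<close> the descent ends at \<open>-1\<close>, a bound
    that already forces \<open>r = 0\<close>.\<close>
  have desc: "tdeg_le (max b (-1)) r" if "tdeg_le (int n) r" for n
    using that
  proof (induction n)
    case 0
    then show ?case
    proof (cases "b < 0")
      case True
      then have "deg_le (int 0 - 1) (family r)" using assms by (auto elim: deg_le_mono)
      from step[OF 0 this] True show ?thesis by (auto simp: max_def)
    qed (auto elim: tdeg_le_mono)
  next
    case (Suc n)
    show ?case
    proof (cases "b \<le> int n")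
      case True
      then have "deg_le (int (Suc n) - 1) (family r)" using assms by (auto elim: deg_le_mono)
      from step[OF Suc.prems this] Suc.IH show ?thesis by simp
    qed (use Suc.prems in \<open>auto elim: tdeg_le_mono\<close>)
  qed
  have t: "tdeg_le (max b (-1)) r" using tdeg_le_exists[of r] desc by blast
  show ?thesis
  proof (cases "b < 0")
    case True
    then have "r = 0" by (intro tdeg_le_neg[OF t]) auto
    then show ?thesis by simp
  next
    case False
    then have "max b (-1) = b" by simp
    with t show ?thesis by metis
  qed
qed

section \<open>Descent of syzygies from lines to the plane\<close>

text \<open>Subtracting from \<open>p\<close> the multiple of \<open>q\<close> that cancels the
  coefficient at \<open>degree q\<close>, after scaling, gives \<open>r\<close> with the same
  vanishing Wronskian. If \<open>r\<close> were nonzero, leading coefficients would give equal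
  degrees in characteristic zero, contrary to the cancellation.\<close>

lemma proportional_of_wronskian:
  fixes p q :: "'r::{idom, ring_char_0} poly"
  assumes W: "p * pderiv q = q * pderiv p"
  shows "smult (lead_coeff q) p = smult (coeff p (degree q)) q"
proof (cases "q = 0")
  case True
  then show ?thesis by simp
next
  case q: False
  define r where "r = smult (lead_coeff q) p - smult (coeff p (degree q)) q"
  have Wr: "r * pderiv q = q * pderiv r"
    using W by (simp add: r_def pderiv_diff pderiv_smult algebra_simps)
  have r0: "coeff r (degree q) = 0"
    by (simp add: r_def)
  have "r = 0"
  proof (rule ccontr)
    assume r: "r \<noteq> 0"
    then have ne: "degree r \<noteq> degree q" using r0 leading_coeff_0_iff[of r] by metis
    \<comment> \<open>This includes constant \<open>u\<close>, where both sides are zero.\<close>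
    have lc: "lead_coeff (pderiv u) = of_nat (degree u) * lead_coeff u" for u :: "'r poly"
      by (cases "degree u") (auto simp: degree_pderiv coeff_pderiv coeff_eq_0)
    have "lead_coeff (r * pderiv q) = lead_coeff (q * pderiv r)" using Wr by simp
    then have "lead_coeff r * (of_nat (degree q) * lead_coeff q)
        = lead_coeff q * (of_nat (degree r) * lead_coeff r)"
      unfolding lead_coeff_mult lc .
    with q r have "(of_nat (degree q) :: 'r) = of_nat (degree r)" by simp
    with ne show False by simp
  qed
  then show ?thesis by (simp add: r_def)
qed

text \<open>The greatest common divisor \<open>e\<close> is divided out. Coprimality of the
  \<open>G i\<close> is stated in the form used later: an element dividing every
  \<open>G i * x\<close> divides their gcd, which is \<open>x\<close> up to a unit.\<close>

lemma exists_coprime_multiple: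
  fixes c :: "'i \<Rightarrow> 'a::factorial_ring_gcd"
  assumes p: "p \<in> I" "c p \<noteq> 0"
  obtains e G where "e \<noteq> 0" "\<And>i. i \<in> I \<Longrightarrow> c i = e * G i"
    "\<And>x. (\<And>i. i \<in> I \<Longrightarrow> G p dvd G i * x) \<Longrightarrow> G p dvd x"
proof -
  define e where "e = Gcd (c ` I)"
  define G where "G i = c i div e" for i
  have e0: "e \<noteq> 0" using p by (auto simp: e_def)
  have cG: "c i = e * G i" if "i \<in> I" for i
  proof -
    have "e dvd c i" unfolding e_def using that by (intro Gcd_dvd) simp
    then show ?thesis by (simp add: G_def)
  qed
  have "normalize (e * Gcd (G ` I)) = normalize e"
  proof -
    have "c ` I = (*) e ` (G ` I)" using cG by (auto simp: image_image)
    then have "e = Gcd ((*) e ` (G ` I))" by (simp add: e_def)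
    also have "\<dots> = normalize (e * Gcd (G ` I))" by (rule Gcd_mult)
    finally have "normalize (e * Gcd (G ` I)) = e" by simp
    then show ?thesis by (metis normalize_idem)
  qed
  then have "e * Gcd (G ` I) dvd e" by (simp add: associated_iff_dvd)
  then have unit: "is_unit (Gcd (G ` I))" using e0 by simp
  show ?thesis
  proof (rule that[OF e0 cG])
    fix x assume x: "\<And>i. i \<in> I \<Longrightarrow> G p dvd G i * x"
    have "G p dvd Gcd ((*) x ` (G ` I))"
      using x by (intro Gcd_greatest) (auto simp: mult.commute)
    then have "G p dvd x * Gcd (G ` I)" by (simp add: Gcd_mult)
    with unit show "G p dvd x" by (simp add: dvd_mult_unit_iff)
  qed
qed

lemma smult_cancel:
  fixes p q :: "'a::idom poly"
  assumes "smult c p = smult c q" "c \<noteq> 0"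
  shows "p = q"
proof -
  have "smult c (p - q) = 0" using assms(1) unfolding smult_diff_right by simp
  with assms(2) show ?thesis unfolding smult_eq_0_iff by simp
qed

text \<open>The vanishing Wronskians make each \<open>g i\<close> proportional to
  \<open>g p\<close>, with ratio \<open>c i : c p\<close> read off at the degree of
  \<open>g p\<close>. Reduced to coprime terms this says \<open>G p * g i = G i * g p\<close>, so
  \<open>G p\<close> divides every coefficient of \<open>g p\<close>, and the quotient is the common
  factor \<open>q\<close>.\<close>

lemma descent_point:
  fixes g :: "'i \<Rightarrow> 'r::{factorial_ring_gcd, ring_char_0} poly"
  assumes W: "\<And>i. i \<in> I \<Longrightarrow> g i * pderiv (g p) = g p * pderiv (g i)"
    and p: "p \<in> I" "g p \<noteq> 0"
  obtains q G where "\<And>i. i \<in> I \<Longrightarrow> g i = q * [:G i:]"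
proof -
  define c where "c i = coeff (g i) (degree (g p))" for i
  have c: "smult (c p) (g i) = smult (c i) (g p)" if "i \<in> I" for i
    using proportional_of_wronskian[OF W[OF that]] by (simp add: c_def)
  have cp: "c p \<noteq> 0" using p by (simp add: c_def)
  obtain e G where eG: "e \<noteq> 0" "\<And>i. i \<in> I \<Longrightarrow> c i = e * G i"
    "\<And>x. (\<And>i. i \<in> I \<Longrightarrow> G p dvd G i * x) \<Longrightarrow> G p dvd x"
    using exists_coprime_multiple[of p I c, OF p(1) cp] by metis
  have G: "smult (G p) (g i) = smult (G i) (g p)" if "i \<in> I" for i
  proof -
    have "smult e (smult (G p) (g i)) = smult e (smult (G i) (g p))"
      using c[OF that] unfolding eG(2)[OF that] eG(2)[OF p(1)] by simp
    then show ?thesis using eG(1) by (rule smult_cancel)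
  qed
  have "G p dvd coeff (g p) n" for n
  proof (rule eG(3))
    fix i assume "i \<in> I"
    from arg_cong[OF G[OF this], of "\<lambda>p. coeff p n"]
    have "G p * coeff (g i) n = G i * coeff (g p) n" by simp
    then show "G p dvd G i * coeff (g p) n" by (metis dvd_triv_left)
  qed
  then have "[:G p:] dvd g p" by (simp add: const_poly_dvd_iff)
  then obtain q where q: "g p = [:G p:] * q" by (elim dvdE)
  have Gp: "G p \<noteq> 0" using cp eG(2)[OF p(1)] by auto
  show ?thesis
  proof (rule that)
    fix i assume "i \<in> I"
    have "smult (G p) (g i) = smult (G p) (smult (G i) q)"
      using G[OF \<open>i \<in> I\<close>] by (simp add: q mult.commute)
    then have "g i = smult (G i) q" using Gp by (rule smult_cancel)
    then show "g i = q * [:G i:]" by simp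
  qed
qed

text \<open>In point coordinates \<open>line_deriv\<close> is the derivative in the outer variable
  \<open>t\<close> and the elements of a family are the constants, so \<open>descent_point\<close>
  applies over the factorial ring of polynomials in \<open>y\<close> and \<open>z\<close>.\<close>

lemma descent:
  fixes g :: "'i \<Rightarrow> 'k::{field_gcd, field_char_0} poly poly poly"
  assumes W: "\<And>i. i \<in> I \<Longrightarrow> g i * line_deriv (g p) = g p * line_deriv (g i)"
    and p: "p \<in> I" "g p \<noteq> 0"
  obtains q G where "q \<noteq> 0" "\<And>i. i \<in> I \<Longrightarrow> g i = q * family (G i)"
proof -
  have inj: "to_point u \<noteq> 0" if "u \<noteq> 0" for u :: "'k poly poly poly"
    by (metis that to_line_to_point to_line_hom(1))
  have W': "to_point (g i) * pderiv (to_point (g p)) = to_point (g p) * pderiv (to_point (g i))"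
    if "i \<in> I" for i
    using arg_cong[OF W[OF that], of to_point] by (simp add: line_deriv_def to_point_hom)
  obtain q G where qG: "\<And>i. i \<in> I \<Longrightarrow> to_point (g i) = q * [:G i:]"
    using descent_point[of I "\<lambda>i. to_point (g i)" p, OF W' p(1) inj[OF p(2)]] by metis
  have *: "g i = to_line q * family (G i)" if "i \<in> I" for i
    using arg_cong[OF qG[OF that], of to_line]
    unfolding to_line_hom family_def to_line_to_point .
  then have "to_line q \<noteq> 0" using p by fastforce
  then show ?thesis using * by (rule that)
qed

text \<open>Each cofactor has its own bound; a negative one switches the cofactor off, so that
  relations between two of the three polynomials are covered as well.\<close>

definition no_syzygy :: "(nat \<Rightarrow> 'a::comm_ring_1 poly) \<Rightarrow> (nat \<Rightarrow> int) \<Rightarrow> bool" where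
  "no_syzygy f b \<longleftrightarrow> (\<forall>g. (\<forall>i<3. deg_le (b i) (g i)) \<longrightarrow> (\<Sum>i<3. g i * f i) = 0 \<longrightarrow> (\<forall>i<3. g i = 0))"

definition no_global_syzygy :: "(nat \<Rightarrow> 'a::comm_ring_1 poly poly) \<Rightarrow> (nat \<Rightarrow> int) \<Rightarrow> bool" where
  "no_global_syzygy F b \<longleftrightarrow>
     (\<forall>G. (\<forall>i<3. tdeg_le (b i) (G i)) \<longrightarrow> (\<Sum>i<3. G i * F i) = 0 \<longrightarrow> (\<forall>i<3. G i = 0))"

lemma no_syzygyD:
  "no_syzygy f b \<Longrightarrow> (\<And>i. i < 3 \<Longrightarrow> deg_le (b i) (g i)) \<Longrightarrow> (\<Sum>i<3. g i * f i) = 0 \<Longrightarrow> i < 3 \<Longrightarrow> g i = 0"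
  unfolding no_syzygy_def by blast

text \<open>The hypothesis \<open>W\<close> says that the ratios of the cofactors are constant under
  the derivation. By \<open>descent\<close> a nonzero syzygy is then \<open>q\<close> times the
  family of a syzygy \<open>G\<close> on the plane, and cancelling \<open>q\<close> does not raise
  degrees, so \<open>G\<close> contradicts \<open>global\<close>.\<close>

lemma no_syzygy_family:
  fixes F :: "nat \<Rightarrow> 'k::{field_gcd, field_char_0} poly poly"
  assumes global: "no_global_syzygy F b"
    and W: "\<And>g i j. \<lbrakk>\<And>i. i < 3 \<Longrightarrow> deg_le (b i) (g i); (\<Sum>i<3. g i * family (F i)) = 0; i < 3; j < 3\<rbrakk>
      \<Longrightarrow> g i * line_deriv (g j) = g j * line_deriv (g i)"
  shows "no_syzygy (\<lambda>i. family (F i)) b"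
  unfolding no_syzygy_def
proof (intro allI impI, rule ccontr)
  fix g p
  assume g: "\<forall>i<3. deg_le (b i) (g i)" "(\<Sum>i<3. g i * family (F i)) = 0" and p: "p < (3::nat)" "g p \<noteq> 0"
  obtain q G where qG: "q \<noteq> 0" "\<And>i. i \<in> {..<3} \<Longrightarrow> g i = q * family (G i)"
    using descent[of "{..<3}" g p] W[of g] g p by auto
  have "tdeg_le (b i) (G i)" if "i < 3" for i
  proof -
    have "deg_le (b i) (q * family (G i))" using g(1) qG(2) that by auto
    then show ?thesis using qG(1) by (intro tdeg_le_of_family) (rule deg_le_mult_cancel)
  qed
  moreover have "(\<Sum>i<3. G i * F i) = 0"
  proof -
    note hom = ring_hom_typeD[OF ring_hom_family] ring_hom_type_sum[OF ring_hom_family]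
    have "q * family (\<Sum>i<3. G i * F i) = (\<Sum>i<3. g i * family (F i))"
      using qG(2) by (simp add: hom sum_distrib_left algebra_simps)
    then have "family (\<Sum>i<3. G i * F i) = 0" using g(2) qG(1) by simp
    \<comment> \<open>The bound \<open>-1\<close> expresses vanishing, so the degree lemma also
      yields injectivity of \<open>family\<close>.\<close>
    then have "tdeg_le (- 1) (\<Sum>i<3. G i * F i)" by (intro tdeg_le_of_family) simp
    then show ?thesis by (rule tdeg_le_neg) simp
  qed
  ultimately have "G p = 0" using global p(1) unfolding no_global_syzygy_def by blast
  with qG(2)[of p] p show False by (simp add: ring_hom_typeD[OF ring_hom_family])
qed

section \<open>Syzygies of bounded degree as solutions of a linear system\<close>

definition poly_of_coeffs :: "int \<Rightarrow> (nat \<Rightarrow> 'a::comm_ring_1) \<Rightarrow> 'a poly" where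
  "poly_of_coeffs b v = (\<Sum>k\<in>{k. int k \<le> b}. monom (v k) k)"

lemma finite_deg_bound [simp]: "finite {k. int k \<le> b}"
  by (rule finite_subset[of _ "{..nat b}"]) auto

lemma card_deg_bound: "int (card {k. int k \<le> b}) = max 0 (b + 1)"
proof (cases "b < 0")
  case True
  then have "{k. int k \<le> b} = {}" by auto
  with True show ?thesis by simp
next
  case False
  then have "{k. int k \<le> b} = {..nat b}" by auto
  with False show ?thesis by simp
qed

lemma coeff_poly_of_coeffs: "coeff (poly_of_coeffs b v) k = (if int k \<le> b then v k else 0)"
  by (simp add: poly_of_coeffs_def coeff_sum if_distrib cong: if_cong)

lemma deg_le_poly_of_coeffs: "deg_le b (poly_of_coeffs b v)"
  by (simp add: deg_le_def coeff_poly_of_coeffs)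

lemma poly_of_coeffs_coeff: "deg_le b p \<Longrightarrow> poly_of_coeffs b (coeff p) = p"
  by (rule poly_eqI) (auto simp: coeff_poly_of_coeffs deg_leD)

text \<open>The pair \<open>(i, k)\<close> stands for the unknown coefficient of index
  \<open>k\<close> in cofactor \<open>i\<close>. Row \<open>n\<close> of \<open>syz_matrix\<close>
  below is the equation for the coefficient of index \<open>n\<close> of the combination.\<close>

definition syz_index :: "(nat \<Rightarrow> int) \<Rightarrow> (nat \<times> nat) set" where
  "syz_index b = (SIGMA i:{..<3}. {k. int k \<le> b i})"

lemma finite_syz_index [simp]: "finite (syz_index b)"
  by (simp add: syz_index_def)

lemma card_syz_index: "int (card (syz_index b)) = (\<Sum>i<3. max 0 (b i + 1))"
  by (simp add: syz_index_def card_SigmaI card_deg_bound flip: int_sum)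

definition syz_matrix :: "(nat \<Rightarrow> 'a::comm_ring_1 poly) \<Rightarrow> nat \<Rightarrow> nat \<times> nat \<Rightarrow> 'a" where
  "syz_matrix f n = (\<lambda>(i, k). if k \<le> n then coeff (f i) (n - k) else 0)"

lemma coeff_syzygy:
  "coeff (\<Sum>i<3. poly_of_coeffs (b i) (\<lambda>k. v (i, k)) * f i) n
     = (\<Sum>x\<in>syz_index b. syz_matrix f n x * v x)"
proof -
  have "coeff (\<Sum>i<3. poly_of_coeffs (b i) (\<lambda>k. v (i, k)) * f i) n
      = (\<Sum>i<3. \<Sum>k\<in>{k. int k \<le> b i}. coeff (monom (v (i, k)) k * f i) n)"
    by (simp add: coeff_sum poly_of_coeffs_def sum_distrib_right)
  also have "\<dots> = (\<Sum>i<3. \<Sum>k\<in>{k. int k \<le> b i}. syz_matrix f n (i, k) * v (i, k))"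
    by (intro sum.cong refl) (simp add: coeff_monom_mult syz_matrix_def)
  finally show ?thesis by (simp add: syz_index_def sum.Sigma)
qed

text \<open>Absence of syzygies means that \<open>syz_matrix f\<close> has trivial kernel, so
  \<open>elimination\<close> can only end with its second alternative, and the matrix of the
  specialised polynomials is the specialised matrix.\<close>

lemma no_syzygy_specialize:
  fixes f :: "nat \<Rightarrow> 'a::idom poly"
  assumes "no_syzygy f b"
  shows "\<exists>\<delta>. \<delta> \<noteq> 0 \<and> (\<forall>\<psi>::'a \<Rightarrow> 'b::idom. ring_hom_type \<psi> \<longrightarrow> \<psi> \<delta> \<noteq> 0 \<longrightarrow> no_syzygy (\<lambda>i. map_poly \<psi> (f i)) b)"
proof -
  from elimination[OF finite_syz_index, of b UNIV "syz_matrix f", where ?'b = 'b]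
  show ?thesis
  proof (elim disjE exE conjE)
    fix v assume v: "\<exists>x\<in>syz_index b. v x \<noteq> 0" "\<forall>n\<in>UNIV. (\<Sum>x\<in>syz_index b. syz_matrix f n x * v x) = 0"
    define g where "g i = poly_of_coeffs (b i) (\<lambda>k. v (i, k))" for i
    have "(\<Sum>i<3. g i * f i) = 0"
      using v(2) unfolding g_def by (intro poly_eqI) (simp only: coeff_syzygy coeff_0 UNIV_I ball_simps)
    then have g0: "g i = 0" if "i < 3" for i
      using no_syzygyD[OF assms, of g] that by (simp add: g_def deg_le_poly_of_coeffs)
    obtain i k where ik: "(i, k) \<in> syz_index b" "v (i, k) \<noteq> 0" using v(1) by auto
    then have "coeff (g i) k = v (i, k)" by (simp add: g_def coeff_poly_of_coeffs syz_index_def)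
    with g0[of i] ik show ?thesis by (simp add: syz_index_def)
  next
    fix \<delta> :: 'a
    assume \<delta>: "\<delta> \<noteq> 0" "\<forall>\<psi>::'a \<Rightarrow> 'b. ring_hom_type \<psi> \<longrightarrow> \<psi> \<delta> \<noteq> 0 \<longrightarrow>
        (\<forall>v. (\<forall>n\<in>UNIV. (\<Sum>x\<in>syz_index b. \<psi> (syz_matrix f n x) * v x) = 0) \<longrightarrow> (\<forall>x\<in>syz_index b. v x = 0))"
    have "no_syzygy (\<lambda>i. map_poly \<psi> (f i)) b"
      if \<psi>: "ring_hom_type \<psi>" "\<psi> \<delta> \<noteq> 0" for \<psi> :: "'a \<Rightarrow> 'b"
      unfolding no_syzygy_def
    proof (intro allI impI)
      fix g i assume g: "\<forall>i<3. deg_le (b i) (g i)" "(\<Sum>i<3. g i * map_poly \<psi> (f i)) = 0" and i: "i < (3::nat)"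
      define v where "v = (\<lambda>(i, k). coeff (g i) k)"
      have gv: "poly_of_coeffs (b i) (\<lambda>k. v (i, k)) = g i" if "i < 3" for i
        using poly_of_coeffs_coeff[of "b i" "g i"] g(1) that by (simp add: v_def)
      have "(\<Sum>x\<in>syz_index b. \<psi> (syz_matrix f n x) * v x) = 0" for n
      proof -
        have "(\<Sum>x\<in>syz_index b. \<psi> (syz_matrix f n x) * v x)
            = (\<Sum>x\<in>syz_index b. syz_matrix (\<lambda>i. map_poly \<psi> (f i)) n x * v x)"
          by (intro sum.cong refl)
             (auto simp: syz_matrix_def coeff_map_poly ring_hom_typeD(1)[OF \<psi>(1)] split: if_splits)
        also have "\<dots> = coeff (\<Sum>i<3. g i * map_poly \<psi> (f i)) n"
          unfolding coeff_syzygy[symmetric] using gv by simp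
        finally show ?thesis using g(2) by simp
      qed
      then have "\<forall>x\<in>syz_index b. v x = 0" using \<delta>(2) \<psi> by blast
      then have "coeff (g i) k = 0" if "int k \<le> b i" for k
        using that i unfolding syz_index_def v_def by auto
      then show "g i = 0"
        using g(1) i by (intro poly_eqI) (metis coeff_0 deg_leD not_le)
    qed
    with \<delta>(1) show ?thesis by blast
  qed
qed

section \<open>Specialisation of the parameters to an individual line\<close>

definition par_eval :: "'k::comm_ring_1 \<Rightarrow> 'k \<Rightarrow> 'k poly poly \<Rightarrow> 'k" where
  "par_eval s t c = poly (poly c [:t:]) s"

definition on_line :: "'k::comm_ring_1 \<Rightarrow> 'k \<Rightarrow> 'k poly poly \<Rightarrow> 'k poly" where
  "on_line s t r = poly r [:s, t:]"

lemma ring_hom_par_eval: "ring_hom_type (par_eval s t)"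
  unfolding ring_hom_type_def par_eval_def by simp

lemma ring_hom_on_line: "ring_hom_type (on_line s t)"
  unfolding ring_hom_type_def on_line_def by simp

lemmas on_line_hom = ring_hom_typeD[OF ring_hom_on_line] ring_hom_type_minus[OF ring_hom_on_line]

lemma map_poly_par_eval_family: "map_poly (par_eval s t) (family r) = on_line s t r"
proof -
  note hom = ring_hom_map_poly[OF ring_hom_par_eval, of s t]
  show ?thesis
  proof (induction r)
    case 0
    then show ?case by (simp add: ring_hom_typeD[OF ring_hom_family] on_line_hom)
  next
    case (pCons a r)
    have "map_poly (par_eval s t) (family [:a:]) = a"
      by (rule poly_eqI) (simp add: family_const coeff_map_poly par_eval_def)
    moreover have "map_poly (par_eval s t) (var_in + var_mid * var_out) = [:s, t:]"
      by (simp add: ring_hom_typeD[OF hom] var_in_def var_mid_def var_out_def map_poly_pCons par_eval_def)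
    ultimately show ?case
      using pCons.IH unfolding family_pCons[of a r] by (simp add: ring_hom_typeD[OF hom] on_line_def)
  qed
qed

text \<open>The field is infinite, so \<open>t\<close> can avoid the finitely many roots of
  \<open>c\<close>, and then \<open>s\<close> those of the resulting polynomial.\<close>

lemma exists_par_eval_nonzero:
  fixes c :: "'k::field_char_0 poly poly"
  assumes "c \<noteq> 0"
  shows "\<exists>s t. par_eval s t c \<noteq> 0"
proof -
  have inf: "infinite (UNIV :: 'k set)" by (rule infinite_UNIV_char_0)
  have "\<exists>t. poly c [:t:] \<noteq> 0"
  proof (rule ccontr)
    assume "\<not> ?thesis"
    then have "range (\<lambda>t. [:t:]) \<subseteq> {x. poly c x = 0}" by auto
    then have "finite (range (\<lambda>t::'k. [:t:]))" using poly_roots_finite[OF assms] finite_subset by blast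
    moreover have "inj (\<lambda>t::'k. [:t:])" by (simp add: inj_def)
    ultimately show False using inf finite_imageD by blast
  qed
  then obtain t where t: "poly c [:t:] \<noteq> 0" by blast
  then have "finite {s. poly (poly c [:t:]) s = 0}" by (rule poly_roots_finite)
  with inf have "\<exists>s. poly (poly c [:t:]) s \<noteq> 0" by (metis (mono_tags, lifting) Collect_cong UNIV_def)
  then show ?thesis unfolding par_eval_def by blast
qed

lemma generic_no_syzygy:
  fixes F :: "nat \<Rightarrow> 'k::field poly poly"
  assumes "no_syzygy (\<lambda>i. family (F i)) b"
  shows "\<exists>\<delta>. \<delta> \<noteq> 0 \<and> (\<forall>s t. par_eval s t \<delta> \<noteq> 0 \<longrightarrow> no_syzygy (\<lambda>i. on_line s t (F i)) b)"
proof -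
  from no_syzygy_specialize[OF assms, where ?'b = 'k] obtain \<delta> where
    "\<delta> \<noteq> 0" "\<forall>\<psi>::'k poly poly \<Rightarrow> 'k. ring_hom_type \<psi> \<longrightarrow> \<psi> \<delta> \<noteq> 0 \<longrightarrow>
       no_syzygy (\<lambda>i. map_poly \<psi> (family (F i))) b" by blast
  then show ?thesis
    using ring_hom_par_eval by (auto simp flip: map_poly_par_eval_family)
qed

section \<open>Syzygies on a line and the Lefschetz maps\<close>

lemma tdeg_le_sum: "(\<And>i. i \<in> S \<Longrightarrow> tdeg_le b (f i)) \<Longrightarrow> tdeg_le b (\<Sum>i\<in>S. f i)"
  by (induction S rule: infinite_finite_induct) (auto intro: tdeg_le_add)

lemma on_line_pCons: "on_line s t (pCons a r) = a + [:s, t:] * on_line s t r"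
  by (simp add: on_line_def)

lemma on_line_const [simp]: "on_line s t [:a:] = a"
  by (simp add: on_line_def)

definition line_form :: "'k::comm_ring_1 \<Rightarrow> 'k \<Rightarrow> 'k poly poly" where
  "line_form s t = [:- [:s, t:], 1:]"

lemma line_form_nonzero: "line_form s t \<noteq> 0"
  by (simp add: line_form_def)

lemma on_line_line_form [simp]: "on_line s t (line_form s t) = 0"
  by (simp add: on_line_def line_form_def)

lemma deg_le_on_line: "tdeg_le b r \<Longrightarrow> deg_le b (on_line s t r)"
proof (induction r arbitrary: b)
  case 0
  then show ?case by (simp add: on_line_hom)
next
  case (pCons a r)
  have "deg_le (1 + (b - 1)) ([:s, t:] * on_line s t r)"
    using pCons by (intro deg_le_mult) (simp_all add: tdeg_le_pCons deg_le_pCons)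
  with pCons.prems show ?case
    unfolding on_line_pCons by (intro deg_le_add) (simp_all add: tdeg_le_pCons)
qed

text \<open>Division with remainder by the polynomial \<open>z - (s + t y)\<close>, monic in
  \<open>z\<close>. The remainder is the value at \<open>z = s + t y\<close>, and the induction
  keeps track of the total degree of the quotient.\<close>

lemma line_form_division:
  fixes r :: "'a::comm_ring_1 poly poly"
  shows "tdeg_le b r \<Longrightarrow> \<exists>r'. r = [:on_line s t r:] + line_form s t * r' \<and> tdeg_le (b - 1) r'"
proof (induction r arbitrary: b)
  case 0
  then show ?case by (intro exI[of _ 0]) (simp add: on_line_hom)
next
  case (pCons a r)
  from pCons.prems have b: "tdeg_le (b - 1) r" by (simp add: tdeg_le_pCons)
  from pCons.IH[OF this] obtain r' where
    r': "r = [:on_line s t r:] + line_form s t * r'" "tdeg_le (b - 1 - 1) r'" by blast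
  have "pCons a r = [:a:] + [:0, 1:] * ([:on_line s t r:] + line_form s t * r')"
    using r'(1) by simp
  also have "\<dots> = [:on_line s t (pCons a r):] + line_form s t * pCons (on_line s t r) r'"
  proof -
    have e1: "[:a + [:s, t:] * on_line s t r:] = [:a:] + [:[:s, t:]:] * [:on_line s t r:]" by simp
    have e2: "pCons (on_line s t r) r' = [:on_line s t r:] + [:0, 1:] * r'" by simp
    have e3: "line_form s t = [:0, 1:] - [:[:s, t:]:]" by (simp add: line_form_def)
    have alg: "u + x * (p + (x - c) * q) = (u + c * p) + (x - c) * (p + x * q)"
      for u x p c q :: "'a poly poly" by (simp add: algebra_simps)
    show ?thesis unfolding on_line_pCons e1 e2 e3 by (rule alg)
  qed
  finally have "pCons a r = [:on_line s t (pCons a r):] + line_form s t * pCons (on_line s t r) r'" .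
  moreover have "tdeg_le (b - 1) (pCons (on_line s t r) r')"
    using r'(2) deg_le_on_line[OF b] by (simp add: tdeg_le_pCons)
  ultimately show ?case by blast
qed

corollary line_form_dvd:
  fixes r :: "'a::comm_ring_1 poly poly"
  assumes "tdeg_le b r" "on_line s t r = 0"
  obtains r' where "r = line_form s t * r'" "tdeg_le (b - 1) r'"
  using line_form_division[OF assms(1), of s t] unfolding assms(2) by auto

definition in_ideal :: "(nat \<Rightarrow> 'a::comm_ring_1 poly poly) \<Rightarrow> (nat \<Rightarrow> nat) \<Rightarrow> int \<Rightarrow> 'a poly poly \<Rightarrow> bool" where
  "in_ideal F d k u \<longleftrightarrow> (\<exists>r. (\<forall>i<3. tdeg_le (k - int (d i)) (r i)) \<and> u = (\<Sum>i<3. r i * F i))"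

definition spans :: "(nat \<Rightarrow> 'a::comm_ring_1 poly) \<Rightarrow> (nat \<Rightarrow> nat) \<Rightarrow> int \<Rightarrow> bool" where
  "spans f d j \<longleftrightarrow>
     (\<forall>q. deg_le j q \<longrightarrow> (\<exists>g. (\<forall>i<3. deg_le (j - int (d i)) (g i)) \<and> q = (\<Sum>i<3. g i * f i)))"

text \<open>A binary form of degree \<open>j + 1\<close> is \<open>x\<close> times a form plus
  \<open>y\<close> times a form, both of degree \<open>j\<close>; with \<open>x = 1\<close> this is
  \<open>q = c + y q'\<close>.\<close>

lemma spans_Suc:
  fixes f :: "nat \<Rightarrow> 'a::comm_ring_1 poly"
  assumes "spans f d (int j)"
  shows "spans f d (int (Suc j))"
  unfolding spans_def
proof (intro allI impI)
  fix q :: "'a poly" assume q: "deg_le (int (Suc j)) q"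
  obtain c q' where cq: "q = pCons c q'" by (cases q)
  have "deg_le (int j) q'" "deg_le (int j) [:c:]" using q by (auto simp: cq deg_le_pCons)
  moreover note span = assms[unfolded spans_def, rule_format]
  ultimately obtain g h where
    g: "\<forall>i<3. deg_le (int j - int (d i)) (g i)" "q' = (\<Sum>i<3. g i * f i)" and
    h: "\<forall>i<3. deg_le (int j - int (d i)) (h i)" "[:c:] = (\<Sum>i<3. h i * f i)"
    using span[of q'] span[of "[:c:]"] by blast
  have "deg_le (int (Suc j) - int (d i)) (h i + [:0, 1:] * g i)" if "i < 3" for i
  proof (rule deg_le_add)
    show "deg_le (int (Suc j) - int (d i)) (h i)"
      by (rule deg_le_mono[of "int j - int (d i)"]) (use h(1) that in auto)
    have "deg_le (1 + (int j - int (d i))) ([:0, 1:] * g i)"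
      using g(1) that by (intro deg_le_mult) (auto simp: deg_le_pCons)
    then show "deg_le (int (Suc j) - int (d i)) ([:0, 1:] * g i)" by (simp add: algebra_simps)
  qed
  moreover have "q = (\<Sum>i<3. (h i + [:0, 1:] * g i) * f i)"
  proof -
    have "q = [:c:] + [:0, 1:] * q'" by (simp add: cq)
    then have "q = (\<Sum>i<3. h i * f i) + [:0, 1:] * (\<Sum>i<3. g i * f i)" unfolding g(2) h(2) .
    then show ?thesis by (simp only: sum.distrib sum_distrib_left distrib_right mult.assoc)
  qed
  ultimately show "\<exists>g. (\<forall>i<3. deg_le (int (Suc j) - int (d i)) (g i)) \<and> q = (\<Sum>i<3. g i * f i)"
    by (intro exI[of _ "\<lambda>i. h i + [:0, 1:] * g i"]) blast
qed

lemma spans_mono: "j \<le> j' \<Longrightarrow> spans f d (int j) \<Longrightarrow> spans f d (int j')"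
  by (induction j' rule: dec_induct) (auto intro: spans_Suc[unfolded of_nat_Suc])

text \<open>This and \<open>inj_at\<close> are surjectivity and injectivity of multiplication by the
  linear form from degree \<open>k\<close> to degree \<open>k + 1\<close> of the quotient,
  dehomogenised.\<close>

definition surj_at :: "(nat \<Rightarrow> 'a::comm_ring_1 poly poly) \<Rightarrow> (nat \<Rightarrow> nat) \<Rightarrow> 'a \<Rightarrow> 'a \<Rightarrow> int \<Rightarrow> bool" where
  "surj_at F d s t k \<longleftrightarrow> (\<forall>w. tdeg_le (k + 1) w \<longrightarrow>
      (\<exists>u. tdeg_le k u \<and> in_ideal F d (k + 1) (w - line_form s t * u)))"

definition inj_at :: "(nat \<Rightarrow> 'a::comm_ring_1 poly poly) \<Rightarrow> (nat \<Rightarrow> nat) \<Rightarrow> 'a \<Rightarrow> 'a \<Rightarrow> int \<Rightarrow> bool" where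
  "inj_at F d s t k \<longleftrightarrow> (\<forall>u. tdeg_le k u \<longrightarrow> in_ideal F d (k + 1) (line_form s t * u) \<longrightarrow> in_ideal F d k u)"

text \<open>The restriction of \<open>w\<close> to the line is a combination of the restricted
  generators. Subtracting the same combination on the plane, with cofactors constant in
  \<open>z\<close>, leaves a multiple of the equation of the line.\<close>

lemma surj_at_of_spans:
  fixes F :: "nat \<Rightarrow> 'a::comm_ring_1 poly poly"
  assumes "spans (\<lambda>i. on_line s t (F i)) d (k + 1)" and F: "\<And>i. i < 3 \<Longrightarrow> tdeg_le (int (d i)) (F i)"
  shows "surj_at F d s t k"
  unfolding surj_at_def
proof (intro allI impI)
  fix w :: "'a poly poly" assume w: "tdeg_le (k + 1) w"
  then obtain g where g: "\<forall>i<3. deg_le (k + 1 - int (d i)) (g i)"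
    "on_line s t w = (\<Sum>i<3. g i * on_line s t (F i))"
    using assms(1)[unfolded spans_def, rule_format, OF deg_le_on_line] by blast
  define v where "v = w - (\<Sum>i<3. [:g i:] * F i)"
  have gt: "tdeg_le (k + 1 - int (d i)) [:g i:]" if "i < 3" for i
    using g(1) that by (auto intro: tdeg_le_const)
  have "tdeg_le (k + 1) ([:g i:] * F i)" if "i < 3" for i
    using tdeg_le_mult[OF gt[OF that] F[OF that]] by simp
  then have "tdeg_le (k + 1) (\<Sum>i<3. [:g i:] * F i)" by (intro tdeg_le_sum) simp
  with w have "tdeg_le (k + 1) v" unfolding v_def by (rule tdeg_le_diff)
  moreover have "on_line s t v = 0"
    using g(2) unfolding v_def
    by (simp only: on_line_hom ring_hom_type_sum[OF ring_hom_on_line] on_line_const) simp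
  ultimately obtain u where u: "v = line_form s t * u" "tdeg_le (k + 1 - 1) u"
    by (rule line_form_dvd)
  from u(1) have "w - line_form s t * u = (\<Sum>i<3. [:g i:] * F i)" by (simp add: v_def algebra_simps)
  with gt have "in_ideal F d (k + 1) (w - line_form s t * u)"
    unfolding in_ideal_def by (intro exI[of _ "\<lambda>i. [:g i:]"] conjI) auto
  moreover have "tdeg_le k u" using u(2) by simp
  ultimately show "\<exists>u. tdeg_le k u \<and> in_ideal F d (k + 1) (w - line_form s t * u)"
    by (intro exI[of _ u] conjI)
qed

text \<open>A relation \<open>l u = \<Sum> r\<^sub>i F\<^sub>i\<close> restricts to a syzygy on the
  line. If that lifts to a syzygy \<open>G\<close> on the plane, then every \<open>r i - G i\<close>
  vanishes on the line, hence is divisible by \<open>l\<close>, and cancelling \<open>l\<close> puts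
  \<open>u\<close> into the ideal.\<close>

lemma inj_at_of_lift:
  fixes F :: "nat \<Rightarrow> 'a::idom poly poly"
  assumes lift: "\<And>g. \<lbrakk>\<And>i. i < 3 \<Longrightarrow> deg_le (k + 1 - int (d i)) (g i); (\<Sum>i<3. g i * on_line s t (F i)) = 0\<rbrakk>
    \<Longrightarrow> \<exists>G. (\<forall>i<3. tdeg_le (k + 1 - int (d i)) (G i) \<and> on_line s t (G i) = g i) \<and> (\<Sum>i<3. G i * F i) = 0"
  shows "inj_at F d s t k"
  unfolding inj_at_def
proof (intro allI impI)
  fix u assume "in_ideal F d (k + 1) (line_form s t * u)"
  then obtain r where r: "\<forall>i<3. tdeg_le (k + 1 - int (d i)) (r i)"
    "line_form s t * u = (\<Sum>i<3. r i * F i)" unfolding in_ideal_def by blast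
  have "on_line s t (\<Sum>i<3. r i * F i) = 0"
    unfolding r(2)[symmetric] by (simp add: on_line_hom)
  then have "(\<Sum>i<3. on_line s t (r i) * on_line s t (F i)) = 0"
    by (simp add: ring_hom_type_sum[OF ring_hom_on_line] on_line_hom)
  moreover have "deg_le (k + 1 - int (d i)) (on_line s t (r i))" if "i < 3" for i
    using r(1) that by (intro deg_le_on_line) simp
  ultimately obtain G where
    G: "\<forall>i<3. tdeg_le (k + 1 - int (d i)) (G i) \<and> on_line s t (G i) = on_line s t (r i)"
    "(\<Sum>i<3. G i * F i) = 0" using lift[of "\<lambda>i. on_line s t (r i)"] by blast
  have "\<exists>v. r i - G i = line_form s t * v \<and> tdeg_le (k - int (d i)) v" if "i < 3" for i
  proof -
    have "tdeg_le (k + 1 - int (d i)) (r i - G i)" using r(1) G(1) that by (auto intro: tdeg_le_diff)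
    moreover have "on_line s t (r i - G i) = 0" using G(1) that by (simp add: on_line_hom)
    ultimately obtain v where "r i - G i = line_form s t * v" "tdeg_le (k + 1 - int (d i) - 1) v"
      by (rule line_form_dvd)
    then show ?thesis by (intro exI[of _ v]) simp
  qed
  then obtain v where v: "\<And>i. i < 3 \<Longrightarrow> r i - G i = line_form s t * v i"
    "\<And>i. i < 3 \<Longrightarrow> tdeg_le (k - int (d i)) (v i)" by metis
  have "line_form s t * u = (\<Sum>i<3. (r i - G i) * F i)"
    by (simp add: r(2) G(2) left_diff_distrib sum_subtractf)
  also have "\<dots> = line_form s t * (\<Sum>i<3. v i * F i)"
    by (simp add: v(1) sum_distrib_left mult.assoc)
  finally have "u = (\<Sum>i<3. v i * F i)" using line_form_nonzero[of s t] by simp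
  with v(2) show "in_ideal F d k u" unfolding in_ideal_def by blast
qed

lemma inj_at_of_no_syzygy:
  fixes F :: "nat \<Rightarrow> 'a::idom poly poly"
  assumes "no_syzygy (\<lambda>i. on_line s t (F i)) (\<lambda>i. k + 1 - int (d i))"
  shows "inj_at F d s t k"
proof (rule inj_at_of_lift)
  fix g assume "\<And>i. i < 3 \<Longrightarrow> deg_le (k + 1 - int (d i)) (g i)" "(\<Sum>i<3. g i * on_line s t (F i)) = 0"
  then have "\<And>i. i < 3 \<Longrightarrow> g i = 0" using no_syzygyD[OF assms] by blast
  then show "\<exists>G. (\<forall>i<3. tdeg_le (k + 1 - int (d i)) (G i) \<and> on_line s t (G i) = g i) \<and> (\<Sum>i<3. G i * F i) = 0"
    by (intro exI[of _ "\<lambda>_. 0"]) (simp add: on_line_hom)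
qed

lemma no_syzygy_mono:
  assumes "no_syzygy f b" "\<And>i. i < 3 \<Longrightarrow> b' i \<le> b i"
  shows "no_syzygy f b'"
  unfolding no_syzygy_def
proof (intro allI impI)
  fix g i assume g: "\<forall>i<3. deg_le (b' i) (g i)" "(\<Sum>i<3. g i * f i) = 0" and i: "i < (3::nat)"
  have "deg_le (b i) (g i)" if "i < 3" for i
    using deg_le_mono[OF _ assms(2)] g(1) that by blast
  from no_syzygyD[OF assms(1) this g(2) i] show "g i = 0" .
qed

section \<open>Syzygies of coprime binary forms\<close>

lemma coeff_mult_top:
  assumes "deg_le (int a) p" "deg_le (int b) q"
  shows "coeff (p * q :: 'a::comm_ring_1 poly) (a + b) = coeff p a * coeff q b"
proof -
  have "coeff (p * q) (a + b) = (\<Sum>i\<le>a + b. coeff p i * coeff q (a + b - i))" by (simp add: coeff_mult)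
  also have "\<dots> = (\<Sum>i\<in>{a}. coeff p i * coeff q (a + b - i))"
  proof (rule sum.mono_neutral_right)
    show "\<forall>i\<in>{..a + b} - {a}. coeff p i * coeff q (a + b - i) = 0"
    proof
      fix i assume "i \<in> {..a + b} - {a}"
      then consider "i > a" | "a + b - i > b" by force
      then show "coeff p i * coeff q (a + b - i) = 0"
        using assms by cases (simp_all add: deg_leD)
    qed
  qed auto
  finally show ?thesis by simp
qed

lemma deg_le_drop:
  assumes "deg_le (int n) p" "coeff p n = 0"
  shows "deg_le (int n - 1) p"
  unfolding deg_le_def
proof (intro allI impI)
  fix k assume "coeff p k \<noteq> 0"
  with assms have "k \<noteq> n" "int k \<le> int n" unfolding deg_le_def by auto
  then show "int k \<le> int n - 1" by linarith
qed

text \<open>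
  Coprimality of two binary forms of degrees \<open>m\<close> and \<open>n\<close>, dehomogenised: it also excludes a
  common zero at infinity.
\<close>

definition coprime_forms :: "nat \<Rightarrow> nat \<Rightarrow> 'a::comm_ring_1 poly \<Rightarrow> 'a poly \<Rightarrow> bool" where
  "coprime_forms m n p q \<longleftrightarrow> (\<forall>h1 h2. deg_le (int n - 1) h1 \<longrightarrow> deg_le (int m - 1) h2 \<longrightarrow>
     h1 * p + h2 * q = 0 \<longrightarrow> h1 = 0 \<and> h2 = 0)"

lemma coprime_formsD:
  assumes "coprime_forms m n p q" "deg_le (int n - 1) h1" "deg_le (int m - 1) h2" "h1 * p + h2 * q = 0"
  shows "h1 = 0 \<and> h2 = 0"
  using assms(1)[unfolded coprime_forms_def, rule_format, OF assms(2-4)] .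

text \<open>Coprime forms have only the Koszul syzygies. The pair of top coefficients of
  \<open>h1\<close>, \<open>h2\<close> is a multiple of that of \<open>q\<close>,
  \<open>- p\<close>, so subtracting a monomial multiple of the Koszul syzygy lowers the degree by
  one, down to the range where coprimality leaves only zero.\<close>

lemma coprime_forms_koszul_step:
  fixes p q :: "'a::field poly"
  assumes cop: "coprime_forms m n p q" and pq: "deg_le (int m) p" "deg_le (int n) q" and pos: "m > 0" "n > 0"
  shows "deg_le (int n + int e - 1) h1 \<Longrightarrow> deg_le (int m + int e - 1) h2 \<Longrightarrow> h1 * p + h2 * q = 0
    \<Longrightarrow> \<exists>c. deg_le (int e - 1) c \<and> h1 = c * q \<and> h2 = - c * p"
proof (induction e arbitrary: h1 h2)
  case 0
  then show ?case using coprime_formsD[OF cop, of h1 h2] by (intro exI[of _ 0]) simp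
next
  case (Suc e)
  have h: "deg_le (int (n + e)) h1" "deg_le (int (m + e)) h2"
    using Suc.prems(1,2) by (simp_all add: algebra_simps)
  \<comment> \<open>There is no common zero at infinity: otherwise \<open>(q, - p)\<close> would lie
    in the range excluded by coprimality, so that \<open>p = 0\<close>, and then
    \<open>(1, 0)\<close> would be an excluded syzygy as well.\<close>
  have nz: "coeff p m \<noteq> 0 \<or> coeff q n \<noteq> 0"
  proof (rule ccontr)
    assume "\<not> ?thesis"
    then have "deg_le (int m - 1) p" "deg_le (int n - 1) q" using pq by (auto intro: deg_le_drop)
    then have "q = 0 \<and> - p = 0"
      by (intro coprime_formsD[OF cop]) (simp_all add: deg_le_uminus)
    then have "(1 :: 'a poly) = 0"
      using coprime_formsD[OF cop, of 1 0] pos by (simp add: one_pCons deg_le_pCons)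
    then show False by simp
  qed
  have "coeff (h1 * p) (m + n + e) = coeff h1 (n + e) * coeff p m"
    using coeff_mult_top[OF h(1) pq(1)] by (simp add: algebra_simps)
  moreover have "coeff (h2 * q) (m + n + e) = coeff h2 (m + e) * coeff q n"
    using coeff_mult_top[OF h(2) pq(2)] by (simp add: algebra_simps)
  ultimately have top: "coeff h1 (n + e) * coeff p m + coeff h2 (m + e) * coeff q n = 0"
    using arg_cong[OF Suc.prems(3), of "\<lambda>u. coeff u (m + n + e)"] by simp
  obtain c where c: "coeff h1 (n + e) = c * coeff q n" "coeff h2 (m + e) = - c * coeff p m"
  proof (cases "coeff q n = 0")
    case True
    with nz top show ?thesis by (intro that[of "- coeff h2 (m + e) / coeff p m"]) auto
  next
    case False
    with top show ?thesis
      by (intro that[of "coeff h1 (n + e) / coeff q n"]) (auto simp: field_simps add_eq_0_iff)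
  qed
  define k where "k = monom c e"
  have k: "deg_le (int e) k" by (simp add: k_def deg_le_def)
  have k_top: "coeff k e = c" by (simp add: k_def)
  have "deg_le (int (n + e)) (h1 - k * q)" "deg_le (int (m + e)) (h2 + k * p)"
    using deg_le_diff[OF h(1), of "k * q"] deg_le_add[OF h(2), of "k * p"]
      deg_le_mult[OF k pq(2)] deg_le_mult[OF k pq(1)]
    by (simp_all only: of_nat_add add.commute)
  moreover have "coeff (h1 - k * q) (n + e) = 0" "coeff (h2 + k * p) (m + e) = 0"
    using coeff_mult_top[OF k pq(2)] coeff_mult_top[OF k pq(1)] c k_top by (simp_all add: add.commute)
  ultimately have "deg_le (int (n + e) - 1) (h1 - k * q)" "deg_le (int (m + e) - 1) (h2 + k * p)"
    by (blast intro: deg_le_drop)+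
  moreover have "(h1 - k * q) * p + (h2 + k * p) * q = 0"
    using Suc.prems(3) by (simp add: algebra_simps)
  ultimately obtain c' where c': "deg_le (int e - 1) c'" "h1 - k * q = c' * q" "h2 + k * p = - c' * p"
    using Suc.IH[of "h1 - k * q" "h2 + k * p"] unfolding of_nat_add by blast
  have "deg_le (int e) (c' + k)" by (intro deg_le_add k deg_le_mono[OF c'(1)]) simp
  moreover have "h1 = (c' + k) * q" "h2 = - (c' + k) * p"
    using c'(2,3) by (simp_all add: algebra_simps add_eq_0_iff)
  ultimately show ?case by (intro exI[of _ "c' + k"]) simp
qed

lemma coprime_forms_koszul:
  fixes p q :: "'a::field poly"
  assumes cop: "coprime_forms m n p q" and pq: "deg_le (int m) p" "deg_le (int n) q" and pos: "m > 0" "n > 0"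
    and h: "deg_le (int n + e) h1" "deg_le (int m + e) h2" "h1 * p + h2 * q = 0"
  obtains c where "deg_le e c" "h1 = c * q" "h2 = - c * p"
proof (cases "e < 0")
  case True
  with h have "deg_le (int n - 1) h1" "deg_le (int m - 1) h2" by (auto elim: deg_le_mono)
  with h(3) coprime_formsD[OF cop] have "h1 = 0" "h2 = 0" by blast+
  then show ?thesis by (intro that[of 0]) simp_all
next
  case False
  \<comment> \<open>The inductive version bounds the factor by \<open>e - 1\<close> for a natural
    number \<open>e\<close>, hence the shift by one.\<close>
  then have e: "e = int (nat (e + 1)) - 1" by simp
  show ?thesis
    using coprime_forms_koszul_step[OF cop pq pos, of "nat (e + 1)" h1 h2] h that False
    by (auto simp: algebra_simps)
qed

lemma sum_less_3: "(\<Sum>i<(3::nat). h i) = h 0 + h 1 + (h 2 :: 'a::comm_monoid_add)"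
  by (simp add: eval_nat_numeral)

lemma all_less_3: "(\<forall>i<(3::nat). P i) \<longleftrightarrow> P 0 \<and> P 1 \<and> P 2"
  by (auto simp: eval_nat_numeral less_Suc_eq)

lemma lessThan_3_perm:
  assumes "i < 3" "j < 3" "k < 3" "i \<noteq> j" "i \<noteq> k" "j \<noteq> (k::nat)"
  shows "{..<3} = {i, j, k}"
  using assms by force

text \<open>The two-by-two minors \<open>w\<close> of two syzygies form a cross product proportional
  to \<open>f\<close>. Their degrees are too small for a nonzero multiple of \<open>f\<close>, which
  coprimality of \<open>f 0\<close> and \<open>f 1\<close> makes precise.\<close>

lemma syzygies_parallel:
  fixes f :: "nat \<Rightarrow> 'a::idom poly"
  assumes cop: "coprime_forms (d 0) (d 1) (f 0) (f 1)" and pos: "d 1 > 0"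
    and g: "\<And>i. i < 3 \<Longrightarrow> deg_le (a - int (d i)) (g i)" "(\<Sum>i<3. g i * f i) = 0"
    and g': "\<And>i. i < 3 \<Longrightarrow> deg_le (a' - int (d i)) (g' i)" "(\<Sum>i<3. g' i * f i) = 0"
    and deg: "a + a' < (\<Sum>i<3. int (d i))" and ij: "i < 3" "j < 3"
  shows "g i * g' j = g j * g' i"
proof -
  define w where "w i j = g i * g' j - g j * g' i" for i j
  have w: "deg_le (a + a' - int (d i) - int (d j)) (w i j)" if "i < 3" "j < 3" for i j
  proof -
    have "deg_le (a - int (d i) + (a' - int (d j))) (g i * g' j)"
      "deg_le (a - int (d j) + (a' - int (d i))) (g j * g' i)"
      using g(1) g'(1) that by (auto intro: deg_le_mult)
    then show ?thesis unfolding w_def by (intro deg_le_diff) (simp_all add: algebra_simps)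
  qed
  have s: "g 0 * f 0 + g 1 * f 1 + g 2 * f 2 = 0" "g' 0 * f 0 + g' 1 * f 1 + g' 2 * f 2 = 0"
    using g(2) g'(2) by (simp_all add: sum_less_3)
  \<comment> \<open>Elimination of \<open>f 2\<close> from the two syzygies.\<close>
  have "w 0 2 * f 0 + w 1 2 * f 1
      = g' 2 * (g 0 * f 0 + g 1 * f 1 + g 2 * f 2) - g 2 * (g' 0 * f 0 + g' 1 * f 1 + g' 2 * f 2)"
    unfolding w_def by (simp add: algebra_simps)
  then have "w 0 2 * f 0 + w 1 2 * f 1 = 0" unfolding s by simp
  \<comment> \<open>The strict inequality \<open>deg\<close> puts both minors into the range where
    coprimality applies.\<close>
  moreover have "deg_le (int (d 1) - 1) (w 0 2)" "deg_le (int (d 0) - 1) (w 1 2)"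
    using deg by (auto intro!: deg_le_mono[OF w] simp: sum_less_3)
  ultimately have w2: "w 0 2 = 0" "w 1 2 = 0" using coprime_formsD[OF cop] by blast+
  have "w 0 1 * f 0 - w 1 2 * f 2
      = g' 1 * (g 0 * f 0 + g 1 * f 1 + g 2 * f 2) - g 1 * (g' 0 * f 0 + g' 1 * f 1 + g' 2 * f 2)"
    unfolding w_def by (simp add: algebra_simps)
  then have "w 0 1 * f 0 = 0" unfolding s w2 by simp
  moreover have "f 0 \<noteq> 0"
    using coprime_formsD[OF cop, of 1 0] pos by (auto simp: one_pCons deg_le_pCons)
  ultimately have "w 0 1 = 0" by simp
  then have "\<forall>i<3. \<forall>j<3. w i j = 0" unfolding all_less_3 using w2 by (simp add: w_def)
  with ij show ?thesis by (simp add: w_def)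
qed

text \<open>The cofactor degrees just below those of the Koszul syzygy of the forms \<open>i\<close>
  and \<open>j\<close>; the value \<open>-1\<close> excludes the third form.\<close>

definition pair_bound :: "(nat \<Rightarrow> nat) \<Rightarrow> nat \<Rightarrow> nat \<Rightarrow> nat \<Rightarrow> int" where
  "pair_bound d i j l = (if l = i then int (d j) - 1 else if l = j then int (d i) - 1 else - 1)"

lemma coprime_forms_of_no_syzygy:
  assumes "no_syzygy f (pair_bound d i j)" "i < 3" "j < 3" "i \<noteq> j"
  shows "coprime_forms (d i) (d j) (f i) (f j)"
  unfolding coprime_forms_def
proof (intro allI impI)
  fix h1 h2 assume h: "deg_le (int (d j) - 1) h1" "deg_le (int (d i) - 1) h2" "h1 * f i + h2 * f j = 0"
  define g where "g l = (if l = i then h1 else if l = j then h2 else 0)" for l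
  have "(\<Sum>l<3. g l * f l) = (\<Sum>l\<in>{i, j}. g l * f l)"
    using assms by (intro sum.mono_neutral_right) (auto simp: g_def)
  also have "\<dots> = 0" using h(3) assms(4) by (simp add: g_def)
  finally have "(\<Sum>l<3. g l * f l) = 0" .
  moreover have "deg_le (pair_bound d i j l) (g l)" for l using h by (simp add: g_def pair_bound_def)
  ultimately have "g i = 0" "g j = 0" using no_syzygyD[OF assms(1), of g] assms(2,3) by blast+
  with assms(4) show "h1 = 0 \<and> h2 = 0" by (simp add: g_def)
qed

text \<open>The unknowns are the coefficients of the cofactors and the scalar \<open>c\<close>; the
  equations are the coefficients of index at most \<open>J\<close> of
  \<open>\<Sum> g\<^sub>i f\<^sub>i - c q\<close> and the vanishing conditions in \<open>E\<close>.
  With more unknowns than equations there is a nontrivial solution: \<open>q\<close> is reached if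
  \<open>c \<noteq> 0\<close>, and a nonzero syzygy appears if \<open>c = 0\<close>.\<close>

lemma syzygy_count:
  fixes f :: "nat \<Rightarrow> 'a::idom poly"
  assumes "\<forall>i<3. deg_le (int (d i)) (f i)" "\<forall>i<3. b i < 0 \<or> b i \<le> int J - int (d i)"
    and q: "deg_le (int J) q" and E: "finite E" "J + card E < card (syz_index b)"
  shows "\<exists>g c. (\<forall>i<3. deg_le (b i) (g i)) \<and> (\<Sum>i<3. g i * f i) = smult c q \<and>
    (\<forall>(i, k)\<in>E. i < 3 \<longrightarrow> coeff (g i) k = 0) \<and> (c \<noteq> 0 \<or> (\<exists>i<3. g i \<noteq> 0))"
proof -
  note f = assms(1)[rule_format] and b = assms(2)[rule_format]
  \<comment> \<open>\<open>None\<close> is the unknown \<open>c\<close> and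
    \<open>Some (i, k)\<close> a cofactor coefficient; a row \<open>Inl n\<close> compares
    coefficients and a row \<open>Inr e\<close> imposes a condition from \<open>E\<close>.\<close>
  define T where "T = insert None (Some ` syz_index b)"
  define S where "S = Inl ` {..J} \<union> Inr ` E"
  define M :: "nat + nat \<times> nat \<Rightarrow> (nat \<times> nat) option \<Rightarrow> 'a" where
    "M r x = (case x of None \<Rightarrow> (case r of Inl n \<Rightarrow> - coeff q n | Inr e \<Rightarrow> 0)
       | Some x \<Rightarrow> (case r of Inl n \<Rightarrow> syz_matrix f n x | Inr e \<Rightarrow> if x = e then 1 else 0))" for r x
  have cardT: "card T = Suc (card (syz_index b))"
    by (simp add: T_def card_image)
  have "card S \<le> Suc J + card E"
    unfolding S_def using card_Un_le[of "Inl ` {..J}" "Inr ` E"] by (simp add: card_image)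
  with E have "card S < card T" unfolding cardT by simp
  moreover have "finite S" "finite T" using E(1) by (simp_all add: S_def T_def)
  ultimately obtain v where v: "\<exists>x\<in>T. v x \<noteq> 0" "\<forall>r\<in>S. (\<Sum>x\<in>T. M r x * v x) = 0"
    using underdetermined_system[of S T M] by blast
  have sumT: "(\<Sum>x\<in>T. M r x * v x) = M r None * v None + (\<Sum>x\<in>syz_index b. M r (Some x) * v (Some x))" for r
    by (simp add: T_def sum.reindex image_iff)
  define g where "g i = poly_of_coeffs (b i) (\<lambda>k. v (Some (i, k)))" for i
  have g: "deg_le (b i) (g i)" for i by (simp add: g_def deg_le_poly_of_coeffs)
  have "(\<Sum>i<3. g i * f i) = smult (v None) q"
  proof (rule poly_eqI)
    fix n
    show "coeff (\<Sum>i<3. g i * f i) n = coeff (smult (v None) q) n"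
    proof (cases "n \<le> J")
      case True
      then have "Inl n \<in> S" by (simp add: S_def)
      with v(2) have "(\<Sum>x\<in>T. M (Inl n) x * v x) = 0" by blast
      then have "(\<Sum>x\<in>syz_index b. syz_matrix f n x * v (Some x)) = coeff q n * v None"
        unfolding sumT by (simp add: M_def)
      moreover have "coeff (\<Sum>i<3. g i * f i) n = (\<Sum>x\<in>syz_index b. syz_matrix f n x * v (Some x))"
        unfolding g_def using coeff_syzygy[of b "\<lambda>x. v (Some x)" f n] by simp
      ultimately show ?thesis by (simp add: mult.commute)
    next
      case False
      have "deg_le (int J) (g i * f i)" if "i < 3" for i
      proof (cases "b i < 0")
        case True
        then have "g i = 0" using g deg_le_neg by blast
        then show ?thesis by simp
      next
        case False
        then have "b i + int (d i) \<le> int J" using b[OF that] by simp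
        with deg_le_mult[OF g f[OF that]] show ?thesis by (rule deg_le_mono)
      qed
      then have "deg_le (int J) (\<Sum>i<3. g i * f i)" by (intro deg_le_sum) simp
      with q False show ?thesis by (simp add: deg_leD)
    qed
  qed
  moreover have "coeff (g i) k = 0" if "(i, k) \<in> E" "i < 3" for i k
  proof (cases "(i, k) \<in> syz_index b")
    case True
    have "Inr (i, k) \<in> S" using that by (simp add: S_def)
    with v(2) have "(\<Sum>x\<in>T. M (Inr (i, k)) x * v x) = 0" by blast
    moreover have "M (Inr (i, k)) None = 0" by (simp add: M_def)
    ultimately have "(\<Sum>x\<in>syz_index b. M (Inr (i, k)) (Some x) * v (Some x)) = 0"
      unfolding sumT by simp
    also have "(\<Sum>x\<in>syz_index b. M (Inr (i, k)) (Some x) * v (Some x))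
        = (\<Sum>x\<in>syz_index b. if x = (i, k) then v (Some x) else 0)"
      by (intro sum.cong) (auto simp: M_def)
    finally show ?thesis using True by (simp add: g_def coeff_poly_of_coeffs)
  next
    case False
    with that(2) show ?thesis by (simp add: g_def coeff_poly_of_coeffs syz_index_def)
  qed
  moreover have "v None \<noteq> 0 \<or> (\<exists>i<3. g i \<noteq> 0)"
  proof (rule ccontr)
    assume H: "\<not> ?thesis"
    then obtain i k where ik: "(i, k) \<in> syz_index b" "v (Some (i, k)) \<noteq> 0"
      using v(1) by (auto simp: T_def)
    then have "coeff (g i) k \<noteq> 0" "i < 3" by (auto simp: g_def coeff_poly_of_coeffs syz_index_def)
    with H show False by auto
  qed
  ultimately show ?thesis
    using g by (intro exI[of _ g] exI[of _ "v None"] conjI) blast+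
qed

section \<open>Unbalanced degrees: two of the three forms decide\<close>

lemma family_eq_0: "family r = 0 \<Longrightarrow> r = 0"
  using tdeg_le_of_family[of "- 1" r] tdeg_le_neg[of "- 1" r] by simp

lemma sum_pair:
  assumes "i < 3" "j < 3" "i \<noteq> j" "\<And>l. l < 3 \<Longrightarrow> l \<noteq> i \<Longrightarrow> l \<noteq> j \<Longrightarrow> h l = 0"
  shows "(\<Sum>l<(3::nat). h l) = h i + (h j :: 'a::comm_monoid_add)"
proof -
  have "(\<Sum>l<3. h l) = (\<Sum>l\<in>{i, j}. h l)"
    using assms by (intro sum.mono_neutral_right) auto
  with assms(3) show ?thesis by simp
qed

text \<open>A two-term relation \<open>g\<^sub>i f\<^sub>i + g\<^sub>j f\<^sub>j = 0\<close> and its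
  derivative, in which the \<open>f\<close>s behave as constants, have a vanishing determinant
  because \<open>f\<^sub>j\<close> is nonzero. That determinant is the Wronskian required for the
  descent.\<close>

lemma no_syzygy_family_pair:
  fixes F :: "nat \<Rightarrow> 'k::{field_gcd, field_char_0} poly poly"
  assumes global: "no_global_syzygy F (pair_bound d i j)" and ij: "i < 3" "j < 3" "i \<noteq> j" and pos: "d i > 0"
  shows "no_syzygy (\<lambda>l. family (F l)) (pair_bound d i j)"
proof (rule no_syzygy_family[OF global])
  fix g a b
  assume g: "\<And>l. l < 3 \<Longrightarrow> deg_le (pair_bound d i j l) (g l)" "(\<Sum>l<3. g l * family (F l)) = 0"
    and ab: "a < (3::nat)" "b < (3::nat)"
  have g0: "g l = 0" if "l < 3" "l \<noteq> i" "l \<noteq> j" for l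
    using g(1)[OF that(1)] that by (intro deg_le_neg) (auto simp: pair_bound_def)
  \<comment> \<open>If \<open>F j\<close> were zero, the cofactor \<open>1\<close> at
    \<open>j\<close> would be a syzygy within the bound \<open>d i - 1 \<ge> 0\<close>.\<close>
  have Fj: "F j \<noteq> 0"
  proof
    assume Fj: "F j = 0"
    define G :: "nat \<Rightarrow> 'k poly poly" where "G l = (if l = j then 1 else 0)" for l
    have "\<forall>l<3. tdeg_le (pair_bound d i j l) (G l)"
      using ij(3) pos by (auto simp: G_def pair_bound_def one_pCons tdeg_le_pCons deg_le_pCons)
    moreover have "(\<Sum>l<3. G l * F l) = 0" using Fj by (intro sum.neutral) (simp add: G_def)
    ultimately have "G j = 0" using global ij(2) unfolding no_global_syzygy_def by blast
    then show False by (simp add: G_def)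
  qed
  define fi fj where "fi = family (F i)" and "fj = family (F j)"
  have fj: "fj \<noteq> 0" using Fj family_eq_0 by (auto simp: fj_def)
  have s: "g i * fi + g j * fj = 0"
    using g(2) sum_pair[of i j "\<lambda>l. g l * family (F l)", OF ij] g0 by (simp add: fi_def fj_def)
  have "line_deriv (g i * fi + g j * fj) = 0" unfolding s by simp
  then have Ds: "line_deriv (g i) * fi + line_deriv (g j) * fj = 0"
    by (simp add: line_deriv_add line_deriv_mult fi_def fj_def mult.commute)
  have "(g i * line_deriv (g j) - g j * line_deriv (g i)) * fj
      = g i * (line_deriv (g i) * fi + line_deriv (g j) * fj) - line_deriv (g i) * (g i * fi + g j * fj)"
    by (simp add: algebra_simps)
  then have "(g i * line_deriv (g j) - g j * line_deriv (g i)) * fj = 0" unfolding s Ds by simp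
  then have main: "g i * line_deriv (g j) = g j * line_deriv (g i)" using fj by simp
  show "g a * line_deriv (g b) = g b * line_deriv (g a)"
  proof (cases "g a = 0 \<or> g b = 0")
    case False
    then have "a \<in> {i, j}" "b \<in> {i, j}" using g0 ab by blast+
    with main show ?thesis by auto
  qed auto
qed

lemma deg_le_smult: "deg_le b p \<Longrightarrow> deg_le b (smult c p :: 'a::comm_ring_1 poly)"
  unfolding deg_le_def
proof (intro allI impI)
  fix k assume "\<forall>k. coeff p k \<noteq> 0 \<longrightarrow> int k \<le> b" "coeff (smult c p) k \<noteq> 0"
  then show "int k \<le> b" by (cases "coeff p k = 0") auto
qed

lemma sum_smult_mult:
  "(\<Sum>l\<in>S. smult c (g l) * f l) = smult c (\<Sum>l\<in>S. g l * f l :: 'a::comm_ring_1 poly)"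
  by (induction S rule: infinite_finite_induct) (simp_all add: smult_add_right)

lemma on_line_smult: "on_line s t (smult c r) = c * on_line s t r"
  by (simp add: on_line_def)

text \<open>For \<open>n + 1 < d k\<close> the form \<open>k\<close> does not enter, the syzygies on
  the line are multiples of the Koszul one and lift to the plane: injectivity. Otherwise
  \<open>n + 1 \<ge> d i + d j - 1\<close>, and from that degree on the two coprime forms span all
  binary forms: surjectivity.\<close>

lemma wlp_on_line_pair:
  fixes F :: "nat \<Rightarrow> 'k::field poly poly"
  assumes ijk: "{..<3} = {i, j, k}" "i \<noteq> j" "i \<noteq> k" "j \<noteq> (k::nat)"
    and F: "\<And>l. l < 3 \<Longrightarrow> tdeg_le (int (d l)) (F l)" and pos: "\<And>l. l < 3 \<Longrightarrow> d l > 0"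
    and deg: "d i + d j \<le> d k + 1"
    and nosyz: "no_syzygy (\<lambda>l. on_line s t (F l)) (pair_bound d i j)"
  shows "inj_at F d s t (int n) \<or> surj_at F d s t (int n)"
proof -
  have lt: "i < 3" "j < 3" "k < 3" using ijk(1) by blast+
  have l_cases: "l = i \<or> l = j \<or> l = k" if "l < 3" for l using ijk(1) that by blast
  define f where "f l = on_line s t (F l)" for l
  have f: "deg_le (int (d l)) (f l)" if "l < 3" for l
    unfolding f_def using F[OF that] by (rule deg_le_on_line)
  then have f': "\<forall>l<3. deg_le (int (d l)) (f l)" by blast
  have nosyz': "no_syzygy f (pair_bound d i j)" using nosyz by (simp add: f_def[abs_def])
  have cop: "coprime_forms (d i) (d j) (f i) (f j)"
    by (rule coprime_forms_of_no_syzygy[OF nosyz' lt(1,2) ijk(2)])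
  show ?thesis
  proof (cases "n + 1 < d k")
    case True
    have "inj_at F d s t (int n)"
    proof (rule inj_at_of_lift)
      fix g assume g: "\<And>l. l < 3 \<Longrightarrow> deg_le (int n + 1 - int (d l)) (g l)"
        "(\<Sum>l<3. g l * on_line s t (F l)) = 0"
      have gk: "g k = 0" using g(1)[OF lt(3)] True by (intro deg_le_neg) auto
      have "g i * f i + g j * f j = 0"
        using g(2) sum_pair[of i j "\<lambda>l. g l * f l", OF lt(1,2) ijk(2)] gk l_cases
        by (auto simp: f_def)
      moreover have "int n + 1 - int (d i) = int (d j) + (int n + 1 - int (d i) - int (d j))"
        "int n + 1 - int (d j) = int (d i) + (int n + 1 - int (d i) - int (d j))" by simp_all
      then have "deg_le (int (d j) + (int n + 1 - int (d i) - int (d j))) (g i)"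
        "deg_le (int (d i) + (int n + 1 - int (d i) - int (d j))) (g j)"
        using g(1)[OF lt(1)] g(1)[OF lt(2)] by metis+
      ultimately obtain c where c: "deg_le (int n + 1 - int (d i) - int (d j)) c"
        "g i = c * f j" "g j = - c * f i"
        using coprime_forms_koszul[OF cop f[OF lt(1)] f[OF lt(2)] pos[OF lt(1)] pos[OF lt(2)]] by blast
      define G where "G l = (if l = i then [:c:] * F j else if l = j then - [:c:] * F i else 0)" for l
      have "tdeg_le (int n + 1 - int (d i)) ([:c:] * F j)"
        using tdeg_le_mult[OF tdeg_le_const[OF c(1)] F[OF lt(2)]] by simp
      moreover have "tdeg_le (int n + 1 - int (d j)) (- [:c:] * F i)"
        using tdeg_le_mult[OF tdeg_le_uminus[OF tdeg_le_const[OF c(1)]] F[OF lt(1)]] by (simp add: algebra_simps)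
      ultimately have "tdeg_le (int n + 1 - int (d l)) (G l)" if "l < 3" for l
        using l_cases[OF that] ijk(2-4) by (auto simp: G_def)
      moreover have "on_line s t (G l) = g l" if "l < 3" for l
        using l_cases[OF that] ijk(2-4) c(2,3) gk by (auto simp: G_def f_def on_line_hom on_line_smult)
      moreover have "(\<Sum>l<3. G l * F l) = G i * F i + G j * F j"
        by (rule sum_pair[OF lt(1,2) ijk(2)]) (simp add: G_def)
      then have "(\<Sum>l<3. G l * F l) = 0" using ijk(2) by (simp add: G_def mult.commute)
      ultimately show "\<exists>G. (\<forall>i<3. tdeg_le (int n + 1 - int (d i)) (G i) \<and> on_line s t (G i) = g i) \<and> (\<Sum>i<3. G i * F i) = 0"
        by (intro exI[of _ G]) simp
    qed
    then show ?thesis ..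
  next
    case False
    define J where "J = d i + d j - 1"
    have J: "int J = int (d i) + int (d j) - 1" using pos[OF lt(1)] by (simp add: J_def)
    have "spans f d (int J)"
      unfolding spans_def
    proof (intro allI impI)
      fix q :: "'k poly" assume q: "deg_le (int J) q"
      \<comment> \<open>There are as many cofactor coefficients as coefficients of a form of degree
        \<open>J\<close>, namely \<open>d i + d j\<close>; the scalar \<open>c\<close> is the one
        unknown in excess.\<close>
      have "int (card (syz_index (pair_bound d i j))) = int (d i) + int (d j)"
        unfolding card_syz_index
        by (subst sum_pair[OF lt(1,2) ijk(2)]) (use ijk(2) in \<open>auto simp: pair_bound_def\<close>)
      then have card: "J + card ({} :: (nat \<times> nat) set) < card (syz_index (pair_bound d i j))"
        using J by simp
      have b: "\<forall>l<3. pair_bound d i j l < 0 \<or> pair_bound d i j l \<le> int J - int (d l)"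
        by (simp add: pair_bound_def J)
      obtain g c where g': "\<forall>l<3. deg_le (pair_bound d i j l) (g l)"
        and g: "(\<Sum>l<3. g l * f l) = smult c q" "c \<noteq> 0 \<or> (\<exists>l<3. g l \<noteq> 0)"
        using syzygy_count[OF f' b q finite.emptyI card] by blast
      note g = g'[rule_format] g
      have c: "c \<noteq> 0"
      proof
        assume "c = 0"
        then have "\<exists>l<3. g l \<noteq> 0" "(\<Sum>l<3. g l * f l) = 0" using g(2,3) by simp_all
        with no_syzygyD[OF nosyz' g(1)] show False by blast
      qed
      have "deg_le (int J - int (d l)) (smult (inverse c) (g l))" if "l < 3" for l
      proof (cases "l = k")
        case True
        then have "g l = 0" using g(1)[OF that] ijk(2-4) by (intro deg_le_neg) (auto simp: pair_bound_def)
        then show ?thesis by simp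
      next
        case False
        then have "pair_bound d i j l = int J - int (d l)"
          using l_cases[OF that] ijk(2-4) by (auto simp: pair_bound_def J)
        with g(1)[OF that] show ?thesis by (simp add: deg_le_smult)
      qed
      moreover have "q = (\<Sum>l<3. smult (inverse c) (g l) * f l)"
        unfolding sum_smult_mult g(2) using c by simp
      ultimately show "\<exists>g. (\<forall>i<3. deg_le (int J - int (d i)) (g i)) \<and> q = (\<Sum>i<3. g i * f i)"
        by (intro exI[of _ "\<lambda>l. smult (inverse c) (g l)"] conjI allI impI)
    qed
    moreover have "J \<le> n + 1" using False deg by (simp add: J_def)
    ultimately have "spans f d (int (n + 1))" using spans_mono by blast
    then have "spans (\<lambda>i. on_line s t (F i)) d (int n + 1)" by (simp add: f_def[abs_def] add.commute)
    from surj_at_of_spans[of s t F d "int n", OF this F] show ?thesis by simp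
  qed
qed

text \<open>Dimension count for the map sending cofactors to their combination. If the degree sum is
  \<open>2 n + 2\<close>, the map in degree \<open>n\<close> is injective between spaces of equal
  dimension, hence onto. If it is \<open>2 n + 3\<close>, the source in degree \<open>n + 1\<close>
  is larger by one, and it remains to see that the kernel has dimension at most one.\<close>

lemma spans_of_no_syzygy:
  fixes f :: "nat \<Rightarrow> 'k::field poly"
  assumes f: "\<And>i. i < 3 \<Longrightarrow> deg_le (int (d i)) (f i)" and pos: "\<And>l. l < 3 \<Longrightarrow> d l > 0"
    and n: "\<And>i. i < 3 \<Longrightarrow> d i \<le> n" "(\<Sum>i<3. d i) = 2 * n + 2 \<or> (\<Sum>i<3. d i) = 2 * n + 3"
    and cop: "coprime_forms (d 0) (d 1) (f 0) (f 1)"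
    and nosyz: "no_syzygy f (\<lambda>i. int n - int (d i))"
  shows "spans f d (int (n + 1))"
proof -
  have solve: "\<exists>g. (\<forall>i<3. deg_le (int m - int (d i)) (g i)) \<and> q = (\<Sum>i<3. g i * f i)"
    if "\<And>i. i < 3 \<Longrightarrow> deg_le (int m - int (d i)) (g i)" "(\<Sum>i<3. g i * f i) = smult c q" "c \<noteq> 0" for g c m and q :: "'k poly"
  proof (intro exI[of _ "\<lambda>l. smult (inverse c) (g l)"] conjI)
    show "\<forall>i<3. deg_le (int m - int (d i)) (smult (inverse c) (g i))"
      using that(1) by (intro allI impI deg_le_smult)
    show "q = (\<Sum>l<3. smult (inverse c) (g l) * f l)"
      unfolding sum_smult_mult that(2) using that(3) by simp
  qed
  have card: "int (card (syz_index (\<lambda>i. int m - int (d i)))) = 3 * int m + 3 - int (\<Sum>i<3. d i)"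
    if "n \<le> m" for m
  proof -
    have "max 0 (int m - int (d i) + 1) = int m - int (d i) + 1" if "i < 3" for i
      using n(1)[OF that] \<open>n \<le> m\<close> by simp
    then have "(\<Sum>i<3. max 0 (int m - int (d i) + 1)) = (\<Sum>i<3. int m - int (d i) + 1)"
      by (intro sum.cong) auto
    also have "\<dots> = 3 * int m + 3 - int (\<Sum>i<3. d i)" by (simp add: sum_less_3)
    finally show ?thesis unfolding card_syz_index .
  qed
  have b: "\<forall>i<3. int m - int (d i) < 0 \<or> int m - int (d i) \<le> int m - int (d i)" for m
    by simp
  have f': "\<forall>i<3. deg_le (int (d i)) (f i)" using f by blast
  show ?thesis
  proof (cases "(\<Sum>i<3. d i) = 2 * n + 2")
    case True
    have "spans f d (int n)"
      unfolding spans_def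
    proof (intro allI impI)
      fix q :: "'k poly" assume q: "deg_le (int n) q"
      have cd: "n + card ({} :: (nat \<times> nat) set) < card (syz_index (\<lambda>i. int n - int (d i)))"
        using card[of n] True by simp
      obtain g c where g': "\<forall>i<3. deg_le (int n - int (d i)) (g i)"
        and g: "(\<Sum>i<3. g i * f i) = smult c q" "c \<noteq> 0 \<or> (\<exists>i<3. g i \<noteq> 0)"
        using syzygy_count[OF f' b q finite.emptyI cd] by blast
      note g = g'[rule_format] g
      have "c \<noteq> 0"
      proof
        assume "c = 0"
        then have "\<exists>l<3. g l \<noteq> 0" "(\<Sum>l<3. g l * f l) = 0" using g(2,3) by simp_all
        with no_syzygyD[OF nosyz g(1)] show False by blast
      qed
      with g(1,2) show "\<exists>g. (\<forall>i<3. deg_le (int n - int (d i)) (g i)) \<and> q = (\<Sum>i<3. g i * f i)"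
        by (rule solve)
    qed
    then show ?thesis using spans_mono[of n "n + 1"] by simp
  next
    case False
    \<comment> \<open>There are \<open>m + 2\<close> cofactor coefficients for the
      \<open>m + 1\<close> coefficients of a form of degree \<open>m\<close>. If the map were not
      onto, there would be two independent syzygies.\<close>
    define m where "m = n + 1"
    have dsum: "(\<Sum>i<3. d i) = 2 * m + 1" using False n(2) by (simp add: m_def)
    \<comment> \<open>If all coefficients at the extreme indices \<open>m - d i\<close> vanished,
      the syzygy would have degree \<open>n\<close>, which \<open>nosyz\<close> excludes.\<close>
    have drop: "\<exists>i<3. coeff (g i) (m - d i) \<noteq> 0"
      if g: "\<And>i. i < 3 \<Longrightarrow> deg_le (int m - int (d i)) (g i)" "(\<Sum>i<3. g i * f i) = 0" "\<exists>i<3. g i \<noteq> 0" for g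
    proof (rule ccontr)
      assume H: "\<not> ?thesis"
      have "deg_le (int n - int (d i)) (g i)" if "i < 3" for i
      proof -
        have e: "int (m - d i) = int m - int (d i)" using n(1)[OF that] by (simp add: m_def of_nat_diff)
        have "deg_le (int (m - d i) - 1) (g i)"
          using g(1)[OF that] H that by (intro deg_le_drop) (auto simp: e)
        then show ?thesis unfolding e by (simp add: m_def)
      qed
      with no_syzygyD[OF nosyz _ g(2)] g(3) show False by blast
    qed
    have "spans f d (int m)"
      unfolding spans_def
    proof (intro allI impI, rule ccontr)
      fix q :: "'k poly" assume q: "deg_le (int m) q"
        and no: "\<nexists>g. (\<forall>i<3. deg_le (int m - int (d i)) (g i)) \<and> q = (\<Sum>i<3. g i * f i)"
      have cd: "m + 1 < card (syz_index (\<lambda>i. int m - int (d i)))"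
        using card[of m] dsum by (simp add: m_def)
      then have cd0: "m + card ({} :: (nat \<times> nat) set) < card (syz_index (\<lambda>i. int m - int (d i)))" by simp
      obtain g c where g': "\<forall>i<3. deg_le (int m - int (d i)) (g i)"
        and g: "(\<Sum>i<3. g i * f i) = smult c q" "c \<noteq> 0 \<or> (\<exists>i<3. g i \<noteq> 0)"
        using syzygy_count[OF f' b q finite.emptyI cd0] by blast
      note g = g'[rule_format] g
      have c: "c = 0" using solve[OF g(1,2)] no by blast
      then have g0: "(\<Sum>i<3. g i * f i) = 0" "\<exists>i<3. g i \<noteq> 0" using g(2,3) by simp_all
      obtain a where a: "a < 3" "coeff (g a) (m - d a) \<noteq> 0" using drop[OF g(1) g0] by blast
      \<comment> \<open>The count leaves room for one more condition: the second syzygy is made to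
        vanish at an extreme coefficient where the first does not.\<close>
      have cd1: "m + card {(a, m - d a)} < card (syz_index (\<lambda>i. int m - int (d i)))" using cd by simp
      obtain g' c' where h: "\<forall>i<3. deg_le (int m - int (d i)) (g' i)"
        and h': "(\<Sum>i<3. g' i * f i) = smult c' q" "\<forall>(i, k)\<in>{(a, m - d a)}. i < 3 \<longrightarrow> coeff (g' i) k = 0"
          "c' \<noteq> 0 \<or> (\<exists>i<3. g' i \<noteq> 0)"
        using syzygy_count[OF f' b q finite.insertI[OF finite.emptyI] cd1]
        by blast
      note g' = h[rule_format] h'
      have "c' = 0" using solve[OF g'(1,2)] no by blast
      then have g0': "(\<Sum>i<3. g' i * f i) = 0" "\<exists>i<3. g' i \<noteq> 0" using g'(2,4) by simp_all
      have a': "coeff (g' a) (m - d a) = 0" using g'(3) a(1) by simp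
      have "coeff (g' i) (m - d i) = 0" if i: "i < 3" for i
      proof -
        have top: "coeff (u i * v j) (m - d i + (m - d j)) = coeff (u i) (m - d i) * coeff (v j) (m - d j)"
          if "\<And>i. i < 3 \<Longrightarrow> deg_le (int m - int (d i)) (u i)" "\<And>i. i < 3 \<Longrightarrow> deg_le (int m - int (d i)) (v i)"
            "i < 3" "j < 3" for u v :: "nat \<Rightarrow> 'k poly" and i j
        proof -
          have e: "int (m - d i) = int m - int (d i)" if "i < 3" for i
            using n(1)[OF that] by (simp add: m_def of_nat_diff)
          show ?thesis using that by (intro coeff_mult_top) (auto simp: e)
        qed
        \<comment> \<open>The syzygies are parallel, as \<open>m + m\<close> is below the degree sum
          \<open>2 m + 1\<close>; extreme coefficients then propagate the vanishing from
          \<open>a\<close> to every \<open>i\<close>.\<close>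
        have "g a * g' i = g i * g' a"
          by (rule syzygies_parallel[OF cop _ g(1) g0(1) g'(1) g0'(1) _ a(1) i])
             (use dsum pos in \<open>auto simp flip: of_nat_sum\<close>)
        then have "coeff (g a) (m - d a) * coeff (g' i) (m - d i) = coeff (g i) (m - d i) * coeff (g' a) (m - d a)"
          using top[of g g' a i] top[of g g' i a] g(1) g'(1) a(1) i by (simp add: add.commute)
        with a(2) a' show ?thesis by simp
      qed
      with drop[OF g'(1) g0'] show False by blast
    qed
    then show ?thesis by (simp add: m_def)
  qed
qed

text \<open>If one degree is at least the sum of the other two minus one, the pair of the other two
  forms decides. Otherwise descent shows that a general line has no syzygy of degree
  \<open>n\<close>; this gives injectivity below degree \<open>n\<close>, and the dimension count
  gives surjectivity from degree \<open>n\<close> on.\<close>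

lemma wlp_generic_line:
  fixes F :: "nat \<Rightarrow> 'k::{field_gcd, field_char_0} poly poly"
  assumes F: "\<And>i. i < 3 \<Longrightarrow> tdeg_le (int (d i)) (F i)" and pos: "\<And>i. i < 3 \<Longrightarrow> d i > 0"
    and pair: "\<And>i j. i < 3 \<Longrightarrow> j < 3 \<Longrightarrow> i \<noteq> j \<Longrightarrow> no_global_syzygy F (pair_bound d i j)"
    and triple: "\<And>n. (\<And>i j. i < 3 \<Longrightarrow> j < 3 \<Longrightarrow> i \<noteq> j \<Longrightarrow> n < d i + d j)
      \<Longrightarrow> no_global_syzygy F (\<lambda>i. int n - int (d i))"
  shows "\<exists>s t. \<forall>n. inj_at F d s t (int n) \<or> surj_at F d s t (int n)"
proof -
  have pair_family: "no_syzygy (\<lambda>l. family (F l)) (pair_bound d i j)" if "i < 3" "j < 3" "i \<noteq> j" for i j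
  proof (rule no_syzygy_family_pair)
    show "no_global_syzygy F (pair_bound d i j)" using that by (rule pair)
    show "0 < d i" using that(1) by (rule pos)
  qed (fact that)+
  have unbalanced: ?thesis if lt: "i < 3" "j < 3" "k < 3" and ijk: "i \<noteq> j" "i \<noteq> k" "j \<noteq> k"
    and deg: "d i + d j \<le> d k + 1" for i j k
  proof -
    from generic_no_syzygy[OF pair_family[OF lt(1,2) ijk(1)]] obtain \<delta> where \<delta>: "\<delta> \<noteq> 0 \<and>
      (\<forall>s t. par_eval s t \<delta> \<noteq> 0 \<longrightarrow> no_syzygy (\<lambda>i. on_line s t (F i)) (pair_bound d i j))" ..
    then obtain s t where "par_eval s t \<delta> \<noteq> 0" using exists_par_eval_nonzero by blast
    with \<delta> have nosyz: "no_syzygy (\<lambda>i. on_line s t (F i)) (pair_bound d i j)" by simp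
    have "inj_at F d s t (int n) \<or> surj_at F d s t (int n)" for n
      by (rule wlp_on_line_pair[of i j k d F s t, OF lessThan_3_perm[OF lt ijk] ijk F pos deg nosyz])
    then show ?thesis by iprover
  qed
  consider "d 0 + d 1 \<le> d 2 + 1" | "d 0 + d 2 \<le> d 1 + 1" | "d 1 + d 2 \<le> d 0 + 1"
    | (balanced) "d 2 + 2 \<le> d 0 + d 1" "d 1 + 2 \<le> d 0 + d 2" "d 0 + 2 \<le> d 1 + d 2" by linarith
  then show ?thesis
  proof cases
    case 1
    then show ?thesis by (intro unbalanced[of 0 1 2]) simp_all
  next
    case 2
    then show ?thesis by (intro unbalanced[of 0 2 1]) simp_all
  next
    case 3
    then show ?thesis by (intro unbalanced[of 1 2 0]) simp_all
  next
    case balanced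
    \<comment> \<open>The largest \<open>n\<close> for which \<open>2 n + 2\<close> does not exceed
      the degree sum; the subtraction is not truncated because the sum is at least two.\<close>
    define n where "n = (\<Sum>i<3. d i) div 2 - 1"
    have dsum: "(\<Sum>i<3. d i) = d 0 + d 1 + d 2" by (simp add: sum_less_3)
    have n: "(\<Sum>i<3. d i) = 2 * n + 2 \<or> (\<Sum>i<3. d i) = 2 * n + 3"
    proof -
      have "D = 2 * (D div 2 - 1) + 2 \<or> D = 2 * (D div 2 - 1) + 3" if "2 \<le> D" for D :: nat
        using that by presburger
      moreover have "2 \<le> (\<Sum>i<3. d i)" using balanced unfolding dsum by linarith
      ultimately show ?thesis unfolding n_def by blast
    qed
    have dn: "d i \<le> n" if "i < 3" for i
    proof -
      have "d 0 \<le> n" "d 1 \<le> n" "d 2 \<le> n" using balanced n unfolding dsum by linarith+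
      then have "\<forall>i<3. d i \<le> n" unfolding all_less_3 by blast
      with that show ?thesis by blast
    qed
    have lt: "n < d i + d j" if "i < 3" "j < 3" "i \<noteq> j" for i j
    proof -
      have l: "n < d 0 + d 1" "n < d 0 + d 2" "n < d 1 + d 2"
        using balanced n unfolding dsum by linarith+
      have "i \<in> {0, 1, 2}" "j \<in> {0, 1, 2}" using that by auto
      with l that(3) show ?thesis by auto
    qed
    have cop_family: "coprime_forms (d 0) (d 1) (family (F 0)) (family (F 1))"
      using coprime_forms_of_no_syzygy[OF pair_family[of 0 1]] by simp
    have triple_family: "no_syzygy (\<lambda>i. family (F i)) (\<lambda>i. int n - int (d i))"
    proof (rule no_syzygy_family)
      show "no_global_syzygy F (\<lambda>i. int n - int (d i))" using lt by (rule triple)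
      fix g i j
      assume g: "\<And>i. i < 3 \<Longrightarrow> deg_le (int n - int (d i)) (g i)" "(\<Sum>i<3. g i * family (F i)) = 0"
        and ij: "i < (3::nat)" "j < (3::nat)"
      have Dg: "deg_le (int n + 1 - int (d i)) (line_deriv (g i))" if "i < 3" for i
        using deg_le_line_deriv[OF g(1)[OF that]] by (simp add: algebra_simps)
      have "(\<Sum>i<3. line_deriv (g i) * family (F i)) = line_deriv (\<Sum>i<3. g i * family (F i))"
        by (simp add: line_deriv_sum line_deriv_mult mult.commute)
      then have Dg0: "(\<Sum>i<3. line_deriv (g i) * family (F i)) = 0" using g(2) by simp
      \<comment> \<open>The degrees \<open>n\<close> of \<open>g\<close> and \<open>n + 1\<close> of
        its derivative add up to \<open>2 n + 1\<close>, less than the degree sum, so the two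
        syzygies are parallel.\<close>
      show "g i * line_deriv (g j) = g j * line_deriv (g i)"
        by (rule syzygies_parallel[where d = d and g = g and g' = "\<lambda>i. line_deriv (g i)", OF cop_family _ g Dg Dg0 _ ij])
           (use n pos in \<open>auto simp flip: of_nat_sum\<close>)
    qed
    have "no_syzygy (\<lambda>l. family (F l)) (pair_bound d 0 1)" by (rule pair_family) simp_all
    from generic_no_syzygy[OF this] obtain \<delta> where \<delta>: "\<delta> \<noteq> 0 \<and>
      (\<forall>s t. par_eval s t \<delta> \<noteq> 0 \<longrightarrow> no_syzygy (\<lambda>i. on_line s t (F i)) (pair_bound d 0 1))" ..
    from generic_no_syzygy[OF triple_family] obtain \<epsilon> where \<epsilon>: "\<epsilon> \<noteq> 0 \<and>
      (\<forall>s t. par_eval s t \<epsilon> \<noteq> 0 \<longrightarrow> no_syzygy (\<lambda>i. on_line s t (F i)) (\<lambda>i. int n - int (d i)))" ..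
    \<comment> \<open>A point outside the zero set of the product satisfies both genericity
      conditions on the line.\<close>
    have "\<delta> * \<epsilon> \<noteq> 0" using \<delta> \<epsilon> by simp
    then obtain s t where "par_eval s t (\<delta> * \<epsilon>) \<noteq> 0" using exists_par_eval_nonzero by blast
    then have nz: "par_eval s t \<delta> \<noteq> 0" "par_eval s t \<epsilon> \<noteq> 0"
      by (auto simp: ring_hom_typeD[OF ring_hom_par_eval])
    note no1 = \<delta>[THEN conjunct2, rule_format, OF nz(1)] and no2 = \<epsilon>[THEN conjunct2, rule_format, OF nz(2)]
    have cop: "coprime_forms (d 0) (d 1) (on_line s t (F 0)) (on_line s t (F 1))"
      using coprime_forms_of_no_syzygy[OF no1] by simp
    have sp: "spans (\<lambda>i. on_line s t (F i)) d (int (n + 1))"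
      by (rule spans_of_no_syzygy[of d "\<lambda>i. on_line s t (F i)", OF deg_le_on_line[OF F] pos dn n cop no2])
    have "inj_at F d s t (int m) \<or> surj_at F d s t (int m)" for m
    proof (cases "m + 1 \<le> n")
      case True
      have "no_syzygy (\<lambda>i. on_line s t (F i)) (\<lambda>i. int m + 1 - int (d i))"
        using True by (intro no_syzygy_mono[OF no2]) simp
      from inj_at_of_no_syzygy[OF this] show ?thesis ..
    next
      case False
      then have "spans (\<lambda>i. on_line s t (F i)) d (int (m + 1))" by (intro spans_mono[OF _ sp]) simp
      then have "spans (\<lambda>i. on_line s t (F i)) d (int m + 1)" by (simp add: add.commute)
      from surj_at_of_spans[of s t F d "int m", OF this F] show ?thesis by simp
    qed
    then show ?thesis by blast
  qed
qed

section \<open>Homogeneous polynomials in three variables\<close>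

lemma to_copy_simps:
  "to_copy 0 = 0" "to_copy (a + b) = to_copy a + to_copy b" "to_copy (a * b) = to_copy a * to_copy b"
  for a b :: "'k::field"
  by (simp_all add: of_copy_inject[symmetric] to_copy_inverse zero_field_copy.rep_eq
      plus_field_copy.rep_eq times_field_copy.rep_eq)

lemma to_copy_eq_0 [simp]: "to_copy a = 0 \<longleftrightarrow> a = (0::'k::field)"
  by (simp add: of_copy_inject[symmetric] to_copy_inverse zero_field_copy.rep_eq)

lemma to_of_copy [simp]: "to_copy (of_copy a) = a"
  by (rule of_copy_inverse)

lemma univ_3: "(UNIV :: 3 set) = {0, 1, 2}"
proof -
  have "card {0, 1, 2 :: 3} = CARD(3)" by simp
  then show ?thesis by (intro sym[OF card_subset_eq]) simp_all
qed

lemma distinct_3: "(0::3) \<noteq> 1" "(0::3) \<noteq> 2" "(1::3) \<noteq> 2"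
  by simp_all

lemma monom_deg_3:
  "monom_deg (m :: 3 \<Rightarrow>\<^sub>0 nat)
     = poly_mapping.lookup m 0 + poly_mapping.lookup m 1 + poly_mapping.lookup m 2"
proof -
  have "monom_deg m = (\<Sum>v\<in>UNIV. poly_mapping.lookup m v)"
    unfolding monom_deg_def by (rule sum.mono_neutral_left) (auto simp: Poly_Mapping.in_keys_iff)
  also have "\<dots> = (\<Sum>v\<in>{0, 1, 2}. poly_mapping.lookup m v)" unfolding univ_3 ..
  also have "\<dots> = poly_mapping.lookup m 0 + (poly_mapping.lookup m 1 + poly_mapping.lookup m 2)"
    using distinct_3 by simp
  finally show ?thesis by (simp only: add.assoc)
qed

lemma monom_deg_add: "monom_deg (m + n :: 3 \<Rightarrow>\<^sub>0 nat) = monom_deg m + monom_deg n"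
  by (simp add: monom_deg_3 lookup_add)

text \<open>An integer degree, as in \<open>deg_le\<close>: a polynomial of negative degree is zero,
  so cofactor degrees need no case distinction.\<close>

definition homog :: "int \<Rightarrow> ('v, 'k::zero) mpoly \<Rightarrow> bool" where
  "homog k p \<longleftrightarrow> (\<forall>m\<in>Poly_Mapping.keys p. int (monom_deg m) = k)"

lemma homogeneous_iff_homog: "homogeneous d p \<longleftrightarrow> homog (int d) p"
  by (simp add: homogeneous_def homog_def)

lemma homog_0 [simp]: "homog k 0"
  by (simp add: homog_def)

lemma homog_neg: "homog k p \<Longrightarrow> k < 0 \<Longrightarrow> p = 0"
  by (rule poly_mapping_eqI) (force simp: homog_def Poly_Mapping.in_keys_iff)

lemma homog_add: "homog k p \<Longrightarrow> homog k q \<Longrightarrow> homog k (p + q)"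
  unfolding homog_def using keys_add by fastforce

lemma homog_uminus: "homog k p \<Longrightarrow> homog k (- p :: ('v, 'k::comm_ring_1) mpoly)"
  unfolding homog_def by (simp add: Poly_Mapping.in_keys_iff)

lemma homog_diff: "homog k p \<Longrightarrow> homog k q \<Longrightarrow> homog k (p - q :: ('v, 'k::comm_ring_1) mpoly)"
  using homog_add[of k p "- q"] homog_uminus by auto

lemma homog_sum: "(\<And>i. i \<in> S \<Longrightarrow> homog k (f i)) \<Longrightarrow> homog k (\<Sum>i\<in>S. f i)"
  by (induction S rule: infinite_finite_induct) (auto intro: homog_add)

lemma homog_single: "int (monom_deg m) = k \<Longrightarrow> homog k (Poly_Mapping.single m c)"
  by (simp add: homog_def)

lemma homog_mult:
  fixes p q :: "(3, 'k::comm_ring_1) mpoly"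
  assumes "homog k p" "homog l q"
  shows "homog (k + l) (p * q)"
  unfolding homog_def
proof
  fix m assume "m \<in> Poly_Mapping.keys (p * q)"
  with keys_mult[of p q] obtain a b where "a \<in> Poly_Mapping.keys p" "b \<in> Poly_Mapping.keys q" "m = a + b" by blast
  with assms show "int (monom_deg m) = k + l" by (simp add: homog_def monom_deg_add)
qed

lemma mpoly_sum_single: "p = (\<Sum>m\<in>Poly_Mapping.keys p. Poly_Mapping.single m (poly_mapping.lookup p m))" for p :: "('v, 'k::comm_ring_1) mpoly"
proof (rule poly_mapping_eqI)
  fix n
  have "poly_mapping.lookup (\<Sum>m\<in>Poly_Mapping.keys p. Poly_Mapping.single m (poly_mapping.lookup p m)) n = (\<Sum>m\<in>Poly_Mapping.keys p. if m = n then poly_mapping.lookup p m else 0)"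
    unfolding lookup_sum by (intro sum.cong) (auto simp: lookup_single when_def)
  then show "poly_mapping.lookup p n = poly_mapping.lookup (\<Sum>m\<in>Poly_Mapping.keys p. Poly_Mapping.single m (poly_mapping.lookup p m)) n"
    by (simp add: Poly_Mapping.in_keys_iff)
qed

section \<open>Homogeneous components and dehomogenisation\<close>

lift_definition homog_part :: "int \<Rightarrow> ('v, 'k::zero) mpoly \<Rightarrow> ('v, 'k) mpoly" is
  "\<lambda>k p m. if int (monom_deg m) = k then p m else 0"
  by (erule finite_subset[rotated]) auto

lemma homog_homog_part: "homog k (homog_part k p)"
  by (auto simp: homog_def Poly_Mapping.in_keys_iff homog_part.rep_eq split: if_splits)

lemma homog_part_of_homog: "homog l p \<Longrightarrow> homog_part k p = (if k = l then p else 0)"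
  by (rule poly_mapping_eqI) (auto simp: homog_def Poly_Mapping.in_keys_iff homog_part.rep_eq)

lemma homog_part_0 [simp]: "homog_part k 0 = 0"
  by (rule poly_mapping_eqI) (simp add: homog_part.rep_eq)

lemma homog_part_add: "homog_part k (p + q) = homog_part k p + homog_part k q"
  by (rule poly_mapping_eqI) (simp add: homog_part.rep_eq lookup_add)

lemma homog_part_sum: "homog_part k (\<Sum>i\<in>S. f i) = (\<Sum>i\<in>S. homog_part k (f i))"
  by (induction S rule: infinite_finite_induct) (simp_all add: homog_part_add)

lemma homog_part_mult:
  fixes p q :: "(3, 'k::comm_ring_1) mpoly"
  assumes q: "homog d q"
  shows "homog_part k (p * q) = homog_part (k - d) p * q"
proof -
  have single: "homog_part k (Poly_Mapping.single m c * q) = homog_part (k - d) (Poly_Mapping.single m c) * q" for m c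
  proof -
    have "homog (int (monom_deg m)) (Poly_Mapping.single m c)" by (rule homog_single) simp
    from homog_part_of_homog[OF homog_mult[OF this q]] homog_part_of_homog[OF this]
    show ?thesis by auto
  qed
  have "homog_part k ((\<Sum>m\<in>Poly_Mapping.keys p. Poly_Mapping.single m (poly_mapping.lookup p m)) * q)
      = homog_part (k - d) (\<Sum>m\<in>Poly_Mapping.keys p. Poly_Mapping.single m (poly_mapping.lookup p m)) * q"
    by (simp add: sum_distrib_right homog_part_sum single)
  then show ?thesis by (simp flip: mpoly_sum_single)
qed

lemma homog_combination:
  fixes F :: "'i \<Rightarrow> (3, 'k::comm_ring_1) mpoly"
  assumes u: "homog k u" "u = (\<Sum>i\<in>S. h i * F i)" and F: "\<And>i. i \<in> S \<Longrightarrow> homog (d i) (F i)"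
  shows "\<exists>h'. (\<forall>i. homog (k - d i) (h' i)) \<and> u = (\<Sum>i\<in>S. h' i * F i)"
proof (intro exI conjI allI)
  show "homog (k - d i) (homog_part (k - d i) (h i))" for i by (rule homog_homog_part)
  have "u = homog_part k u" using homog_part_of_homog[OF u(1)] by simp
  also have "\<dots> = (\<Sum>i\<in>S. homog_part (k - d i) (h i) * F i)"
    unfolding u(2) homog_part_sum using F by (intro sum.cong refl homog_part_mult) simp
  finally show "u = (\<Sum>i\<in>S. homog_part (k - d i) (h i) * F i)" .
qed

text \<open>The variable of index 0 is set to one; indices 1 and 2 become the inner variable
  \<open>y\<close> and the outer variable \<open>z\<close>. Coefficients move to the copy of the
  field so that gcds are available.\<close>

definition dehomogenize :: "(3, 'k::field) mpoly \<Rightarrow> 'k field_copy poly poly" where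
  "dehomogenize p = (\<Sum>m\<in>Poly_Mapping.keys p. monom (monom (to_copy (poly_mapping.lookup p m)) (poly_mapping.lookup m 1)) (poly_mapping.lookup m 2))"

lemma dehomogenize_add: "dehomogenize (p + q) = dehomogenize p + dehomogenize q"
  unfolding dehomogenize_def
  by (rule setsum_keys_plus_distrib) (simp_all add: to_copy_simps add_monom[symmetric])

lemma dehomogenize_single:
  "dehomogenize (Poly_Mapping.single m c) = monom (monom (to_copy c) (poly_mapping.lookup m 1)) (poly_mapping.lookup m 2)"
  by (simp add: dehomogenize_def to_copy_simps)

lemma dehomogenize_0 [simp]: "dehomogenize 0 = 0"
  by (simp add: dehomogenize_def)

lemma dehomogenize_sum: "dehomogenize (\<Sum>i\<in>S. f i) = (\<Sum>i\<in>S. dehomogenize (f i))"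
  by (induction S rule: infinite_finite_induct) (simp_all add: dehomogenize_add)

lemma dehomogenize_mult: "dehomogenize (p * q) = dehomogenize p * dehomogenize q"
proof -
  let ?s = "\<lambda>p. \<Sum>m\<in>Poly_Mapping.keys p. Poly_Mapping.single m (poly_mapping.lookup p m)"
  have "dehomogenize (?s p * ?s q) = dehomogenize (?s p) * dehomogenize (?s q)"
    by (simp add: sum_product dehomogenize_sum mult_single dehomogenize_single to_copy_simps
        lookup_add mult_monom)
  then show ?thesis by (simp flip: mpoly_sum_single)
qed

lemma dehomogenize_uminus: "dehomogenize (- p) = - dehomogenize p"
proof -
  have "dehomogenize (- p) + dehomogenize p = 0" by (simp flip: dehomogenize_add)
  then show ?thesis by (simp add: eq_neg_iff_add_eq_0)
qed

lemma dehomogenize_diff: "dehomogenize (p - q) = dehomogenize p - dehomogenize q"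
  using dehomogenize_add[of p "- q"] by (simp add: dehomogenize_uminus)

lemma tdeg_le_dehomogenize:
  assumes "homog k p"
  shows "tdeg_le k (dehomogenize p)"
  unfolding dehomogenize_def
proof (rule tdeg_le_sum)
  fix m assume "m \<in> Poly_Mapping.keys p"
  with assms have "int (poly_mapping.lookup m 1) + int (poly_mapping.lookup m 2) \<le> k"
    by (auto simp: homog_def monom_deg_3)
  then show "tdeg_le k (monom (monom (to_copy (poly_mapping.lookup p m)) (poly_mapping.lookup m 1)) (poly_mapping.lookup m 2))"
    by (intro tdeg_leI) (auto split: if_splits)
qed

lemma exponent_eqI:
  fixes m n :: "3 \<Rightarrow>\<^sub>0 nat"
  assumes "monom_deg m = monom_deg n" "poly_mapping.lookup m 1 = poly_mapping.lookup n 1" "poly_mapping.lookup m 2 = poly_mapping.lookup n 2"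
  shows "m = n"
proof (rule poly_mapping_eqI)
  fix v :: 3
  have "v \<in> {0, 1, 2}" using univ_3 by blast
  with assms show "poly_mapping.lookup m v = poly_mapping.lookup n v" by (auto simp: monom_deg_3)
qed

text \<open>In a fixed degree the exponent of the variable of index 0 is determined by the other
  two, so distinct monomials stay distinct.\<close>

lemma dehomogenize_inj:
  assumes "homog k p" "dehomogenize p = 0"
  shows "p = 0"
proof -
  have "poly_mapping.lookup p n = 0" if n: "n \<in> Poly_Mapping.keys p" for n
  proof -
    have "coeff (coeff (dehomogenize p) (poly_mapping.lookup n 2)) (poly_mapping.lookup n 1)
        = (\<Sum>m\<in>Poly_Mapping.keys p. if m = n then to_copy (poly_mapping.lookup p m) else 0)"
      unfolding dehomogenize_def coeff_sum
    proof (intro sum.cong refl)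
      fix m assume m: "m \<in> Poly_Mapping.keys p"
      have "monom_deg m = monom_deg n" using m n assms(1) unfolding homog_def by (metis of_nat_eq_iff)
      then have "m = n \<longleftrightarrow> poly_mapping.lookup m 1 = poly_mapping.lookup n 1 \<and> poly_mapping.lookup m 2 = poly_mapping.lookup n 2"
        using exponent_eqI[of m n] by auto
      then show "coeff (coeff (monom (monom (to_copy (poly_mapping.lookup p m)) (poly_mapping.lookup m 1)) (poly_mapping.lookup m 2)) (poly_mapping.lookup n 2)) (poly_mapping.lookup n 1)
          = (if m = n then to_copy (poly_mapping.lookup p m) else 0)" by auto
    qed
    also have "\<dots> = to_copy (poly_mapping.lookup p n)" using n by simp
    finally show ?thesis unfolding assms(2) by simp
  qed
  then show ?thesis by (intro poly_mapping_eqI) (auto simp: Poly_Mapping.in_keys_iff)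
qed

lemma homogenize:
  fixes r :: "'k::field field_copy poly poly"
  assumes "tdeg_le b r"
  shows "\<exists>p. homog b p \<and> dehomogenize p = r"
proof (cases "b < 0")
  case True
  with assms have "r = 0" by (rule tdeg_le_neg)
  then show ?thesis by (intro exI[of _ 0]) simp_all
next
  case False
  \<comment> \<open>The exponent vector of \<open>y^i z^j\<close> padded to degree \<open>b\<close>
    by the variable of index 0; the sums below run only over indices where the subtraction is
    exact.\<close>
  define e :: "nat \<Rightarrow> nat \<Rightarrow> 3 \<Rightarrow>\<^sub>0 nat" where
    "e i j = Poly_Mapping.single 0 (nat b - i - j) + Poly_Mapping.single 1 i + Poly_Mapping.single 2 j" for i j
  have e: "poly_mapping.lookup (e i j) 0 = nat b - i - j" "poly_mapping.lookup (e i j) 1 = i" "poly_mapping.lookup (e i j) 2 = j" for i j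
    using distinct_3 by (simp_all add: e_def lookup_add lookup_single)
  define p where "p = (\<Sum>j\<le>nat b. \<Sum>i\<le>nat b - j. Poly_Mapping.single (e i j) (of_copy (coeff (coeff r j) i)))"
  have "homog b p"
    unfolding p_def using False by (intro homog_sum homog_single) (auto simp: monom_deg_3 e)
  moreover have "dehomogenize p = r"
  proof -
    have "dehomogenize p = (\<Sum>j\<le>nat b. monom (\<Sum>i\<le>nat b - j. monom (coeff (coeff r j) i) i) j)"
      by (simp add: p_def dehomogenize_sum dehomogenize_single e monom_sum)
    also have "\<dots> = (\<Sum>j\<le>nat b. monom (coeff r j) j)"
    proof (rule sum.cong[OF refl])
      fix j assume "j \<in> {..nat b}"
      have "degree (coeff r j) \<le> nat b - j"
      proof (rule degree_le, intro allI impI)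
        fix i assume "nat b - j < i"
        with \<open>j \<in> {..nat b}\<close> False have "b < int j + int i" by simp
        with assms show "coeff (coeff r j) i = 0" by (rule tdeg_leD)
      qed
      then show "monom (\<Sum>i\<le>nat b - j. monom (coeff (coeff r j) i) i) j = monom (coeff r j) j"
        by (simp add: poly_as_sum_of_monoms')
    qed
    also have "\<dots> = r"
    proof (rule poly_as_sum_of_monoms')
      show "degree r \<le> nat b"
      proof (rule degree_le, intro allI impI)
        fix j assume "nat b < j"
        then have "coeff (coeff r j) i = 0" for i by (intro tdeg_leD[OF assms]) linarith
        then show "coeff r j = 0" by (intro poly_eqI) simp
      qed
    qed
    finally show ?thesis .
  qed
  ultimately show ?thesis by blast
qed

section \<open>Ideals and regular sequences\<close>

lemma type_algebra_simps:
  "carrier ring_of_type_algebra = UNIV" "x \<otimes>\<^bsub>ring_of_type_algebra\<^esub> y = x * y"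
  "x \<oplus>\<^bsub>ring_of_type_algebra\<^esub> y = x + y" "\<zero>\<^bsub>ring_of_type_algebra\<^esub> = 0"
  by (simp_all add: ring_of_type_algebra_def)

lemma ideal_type_algebraD:
  fixes I :: "'a::comm_ring_1 set"
  assumes "ideal I ring_of_type_algebra"
  shows "0 \<in> I" "a \<in> I \<Longrightarrow> b \<in> I \<Longrightarrow> a + b \<in> I" "a \<in> I \<Longrightarrow> x * a \<in> I"
    "a \<in> I \<Longrightarrow> b \<in> I \<Longrightarrow> a - b \<in> I"
proof -
  interpret ideal I ring_of_type_algebra by (rule assms)
  note I = ideal.axioms(1)[OF assms]
  show "0 \<in> I" using additive_subgroup.zero_closed[OF I] by (simp add: type_algebra_simps)
  show add: "a + b \<in> I" if "a \<in> I" "b \<in> I" for a b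
    using additive_subgroup.a_closed[OF I that] by (simp add: type_algebra_simps)
  show mult: "x * a \<in> I" if "a \<in> I" for x a
    using I_l_closed[OF that, of x] by (simp add: type_algebra_simps)
  show "a - b \<in> I" if "a \<in> I" "b \<in> I" for a b
    using add[OF that(1) mult[OF that(2), of "- 1"]] by simp
qed

lemma genideal_type_algebra:
  fixes F :: "'i \<Rightarrow> 'a::comm_ring_1"
  assumes "finite S"
  shows "Idl\<^bsub>ring_of_type_algebra\<^esub> (F ` S) = {\<Sum>i\<in>S. h i * F i |h. True}" (is "?I = ?J")
proof
  interpret ring "ring_of_type_algebra :: 'a ring" by (rule ring_from_type_algebra)
  have I: "ideal ?I ring_of_type_algebra" by (rule genideal_ideal) (simp add: type_algebra_simps)
  note D = ideal_type_algebraD[OF I]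
  have FI: "F i \<in> ?I" if "i \<in> S" for i
    using genideal_self[of "F ` S"] that by (auto simp: type_algebra_simps)
  have "(\<Sum>i\<in>T. h i * F i) \<in> ?I" if "T \<subseteq> S" for h T
    using finite_subset[OF that assms] that
    by (induction T rule: finite_induct) (auto intro: D FI)
  then show "?J \<subseteq> ?I" by blast
  have J: "(\<Sum>i\<in>S. h i * F i) \<in> ?J" for h by blast
  have "ideal ?J ring_of_type_algebra"
  proof (rule idealI)
    show "subgroup ?J (add_monoid ring_of_type_algebra)"
    proof (rule add.subgroupI)
      show "?J \<subseteq> carrier ring_of_type_algebra" by (simp add: type_algebra_simps)
      show "?J \<noteq> {}" by blast
      show "\<ominus>\<^bsub>ring_of_type_algebra\<^esub> a \<in> ?J" if "a \<in> ?J" for a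
      proof -
        from that obtain h where h: "a = (\<Sum>i\<in>S. h i * F i)" by blast
        have "\<ominus>\<^bsub>ring_of_type_algebra\<^esub> a = - a"
          by (rule minus_equality) (simp_all add: type_algebra_simps)
        also have "- a = (\<Sum>i\<in>S. (- h i) * F i)" by (simp add: h sum_negf)
        finally have *: "\<ominus>\<^bsub>ring_of_type_algebra\<^esub> a = (\<Sum>i\<in>S. (- h i) * F i)" .
        show ?thesis unfolding * by (rule J)
      qed
      show "a \<oplus>\<^bsub>ring_of_type_algebra\<^esub> b \<in> ?J" if ab: "a \<in> ?J" "b \<in> ?J" for a b
      proof -
        from ab obtain h h' where "a = (\<Sum>i\<in>S. h i * F i)" "b = (\<Sum>i\<in>S. h' i * F i)" by blast
        then have *: "a \<oplus>\<^bsub>ring_of_type_algebra\<^esub> b = (\<Sum>i\<in>S. (h i + h' i) * F i)"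
          by (simp add: type_algebra_simps distrib_right sum.distrib)
        show ?thesis unfolding * by (rule J)
      qed
    qed
    fix a x assume "a \<in> ?J"
    then obtain h where "a = (\<Sum>i\<in>S. h i * F i)" by blast
    then have *: "x * a = (\<Sum>i\<in>S. (x * h i) * F i)" by (simp add: sum_distrib_left mult.assoc)
    have "x * a \<in> ?J" unfolding * by (rule J)
    then show "x \<otimes>\<^bsub>ring_of_type_algebra\<^esub> a \<in> ?J" "a \<otimes>\<^bsub>ring_of_type_algebra\<^esub> x \<in> ?J"
      by (simp_all only: type_algebra_simps mult.commute)
  qed (rule ring_from_type_algebra)
  moreover have "F ` S \<subseteq> ?J"
  proof
    fix y assume "y \<in> F ` S"
    then obtain j where j: "j \<in> S" "y = F j" by blast
    then have *: "y = (\<Sum>i\<in>S. (if i = j then 1 else 0) * F i)"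
      using assms by (simp add: if_distrib[of "\<lambda>x. x * _"] cong: if_cong)
    show "y \<in> ?J" unfolding * by (rule J)
  qed
  ultimately show "?I \<subseteq> ?J" by (rule genideal_minimal)
qed

section \<open>Computation in the quotient by an ideal\<close>

lemma coset_type_algebra_eq_iff:
  fixes I :: "'a::comm_ring_1 set"
  assumes "ideal I ring_of_type_algebra"
  shows "I +>\<^bsub>ring_of_type_algebra\<^esub> a = I +>\<^bsub>ring_of_type_algebra\<^esub> b \<longleftrightarrow> a - b \<in> I"
proof
  note D = ideal_type_algebraD[OF assms]
  have mem: "x \<in> I +>\<^bsub>ring_of_type_algebra\<^esub> c \<longleftrightarrow> x - c \<in> I" for x c
    by (auto simp: a_r_coset_def' type_algebra_simps intro: bexI[of _ "x - c"])
  show "a - b \<in> I" if "I +>\<^bsub>ring_of_type_algebra\<^esub> a = I +>\<^bsub>ring_of_type_algebra\<^esub> b"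
    using mem[of a a] mem[of a b] that D(1) by simp
  show "I +>\<^bsub>ring_of_type_algebra\<^esub> a = I +>\<^bsub>ring_of_type_algebra\<^esub> b" if ab: "a - b \<in> I"
  proof (rule Set.set_eqI)
    fix x
    have "x - a \<in> I \<longleftrightarrow> x - b \<in> I"
      using D(2)[OF _ ab, of "x - a"] D(4)[OF _ ab, of "x - b"] by auto
    then show "x \<in> I +>\<^bsub>ring_of_type_algebra\<^esub> a \<longleftrightarrow> x \<in> I +>\<^bsub>ring_of_type_algebra\<^esub> b"
      by (simp add: mem)
  qed
qed

lemma coset_type_algebra_mult:
  fixes I :: "'a::comm_ring_1 set"
  assumes "ideal I ring_of_type_algebra"
  shows "(I +>\<^bsub>ring_of_type_algebra\<^esub> a) \<otimes>\<^bsub>ring_of_type_algebra Quot I\<^esub> (I +>\<^bsub>ring_of_type_algebra\<^esub> b)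
    = I +>\<^bsub>ring_of_type_algebra\<^esub> (a * b)"
  using ideal.rcoset_mult_add[OF assms, of a b] by (simp add: FactRing_def type_algebra_simps)

lemma regular_sequence_type_algebraD:
  fixes fs :: "'a::comm_ring_1 list"
  assumes reg: "regular_sequence ring_of_type_algebra fs" and i: "i < length fs"
    and mem: "fs ! i * h \<in> Idl\<^bsub>ring_of_type_algebra\<^esub> (set (take i fs))"
  shows "h \<in> Idl\<^bsub>ring_of_type_algebra\<^esub> (set (take i fs))"
proof -
  let ?R = "ring_of_type_algebra :: 'a ring"
  interpret ring ?R by (rule ring_from_type_algebra)
  define J where "J = Idl\<^bsub>?R\<^esub> (set (take i fs))"
  have J: "ideal J ?R"
    unfolding J_def by (rule genideal_ideal) (simp add: type_algebra_simps)
  have zero: "\<zero>\<^bsub>?R Quot J\<^esub> = J +>\<^bsub>?R\<^esub> 0"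
  proof -
    have "J +>\<^bsub>?R\<^esub> 0 = J" by (simp add: a_r_coset_def' type_algebra_simps)
    then show ?thesis by (simp add: FactRing_def)
  qed
  have "\<forall>a\<in>carrier (?R Quot J). (J +>\<^bsub>?R\<^esub> (fs ! i)) \<otimes>\<^bsub>?R Quot J\<^esub> a = \<zero>\<^bsub>?R Quot J\<^esub> \<longrightarrow> a = \<zero>\<^bsub>?R Quot J\<^esub>"
    using reg i unfolding regular_sequence_def J_def Let_def by blast
  moreover have "J +>\<^bsub>?R\<^esub> h \<in> carrier (?R Quot J)"
    by (auto simp: FactRing_def A_RCOSETS_def' type_algebra_simps)
  moreover have "(J +>\<^bsub>?R\<^esub> (fs ! i)) \<otimes>\<^bsub>?R Quot J\<^esub> (J +>\<^bsub>?R\<^esub> h) = \<zero>\<^bsub>?R Quot J\<^esub>"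
    unfolding coset_type_algebra_mult[OF J] zero coset_type_algebra_eq_iff[OF J]
    using mem by (simp add: J_def)
  ultimately have "J +>\<^bsub>?R\<^esub> h = J +>\<^bsub>?R\<^esub> 0" unfolding zero by blast
  then show ?thesis unfolding coset_type_algebra_eq_iff[OF J] by (simp add: J_def)
qed

text \<open>Regularity is unfolded into relations with explicit cofactors, so that the arguments
  below stay in the polynomial ring.\<close>

locale homog_regular_3 =
  fixes F :: "nat \<Rightarrow> (3, 'k::field) mpoly" and d :: "nat \<Rightarrow> nat"
  assumes F: "\<And>i. i < 3 \<Longrightarrow> homog (int (d i)) (F i)" and pos: "\<And>i. i < 3 \<Longrightarrow> d i > 0"
    and reg0: "\<And>h. F 0 * h = 0 \<Longrightarrow> h = 0"
    and reg1: "\<And>h a. F 1 * h = F 0 * a \<Longrightarrow> \<exists>a'. h = F 0 * a'"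
    and reg2: "\<And>h a b. F 2 * h = F 0 * a + F 1 * b \<Longrightarrow> \<exists>a' b'. h = F 0 * a' + F 1 * b'"
begin

section \<open>Low-degree syzygies of a homogeneous regular sequence\<close>

lemma homog_combination_F:
  assumes "homog e h" "h = (\<Sum>i<n. u i * F i)" "n \<le> 3"
  shows "\<exists>v. (\<forall>i. homog (e - int (d i)) (v i)) \<and> h = (\<Sum>i<n. v i * F i)"
proof -
  have "homog (int (d i)) (F i)" if "i \<in> {..<n}" for i using F[of i] that assms(3) by simp
  from homog_combination[of e h u F "{..<n}" "\<lambda>i. int (d i)", OF assms(1,2) this] show ?thesis .
qed

lemma reg1_homog:
  assumes "homog e h" "F 1 * h = F 0 * a"
  shows "\<exists>a'. homog (e - int (d 0)) a' \<and> h = F 0 * a'"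
proof -
  obtain c where "h = F 0 * c" using reg1[OF assms(2)] ..
  then have "h = (\<Sum>i<1. c * F i)" by (simp add: mult.commute)
  from homog_combination_F[OF assms(1) this] obtain v where
    v: "(\<forall>i. homog (e - int (d i)) (v i)) \<and> h = (\<Sum>i<1. v i * F i)" by auto
  then show ?thesis by (intro exI[of _ "v 0"]) (simp add: mult.commute)
qed

lemma reg2_homog:
  assumes "homog e h" "F 2 * h = F 0 * a + F 1 * b"
  shows "\<exists>a' b'. homog (e - int (d 0)) a' \<and> homog (e - int (d 1)) b' \<and> h = F 0 * a' + F 1 * b'"
proof -
  have sum2: "(\<Sum>i<2. g i) = g 0 + g 1" for g :: "nat \<Rightarrow> (3, 'k) mpoly"
    by (simp add: eval_nat_numeral)
  from reg2[OF assms(2)] obtain u v where "h = F 0 * u + F 1 * v" by (elim exE)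
  then have "h = (\<Sum>i<2. (if i = 0 then u else v) * F i)" unfolding sum2 by (simp add: mult.commute)
  from homog_combination_F[OF assms(1) this] obtain w where
    w: "(\<forall>i. homog (e - int (d i)) (w i)) \<and> h = (\<Sum>i<2. w i * F i)" by auto
  then have "h = F 0 * w 0 + F 1 * w 1" unfolding sum2 by (simp add: mult.commute)
  with w show ?thesis by (intro exI[of _ "w 0"] exI[of _ "w 1"] conjI) simp_all
qed

text \<open>Regularity gives \<open>h = F 0 * a\<close>, and cancelling \<open>F 0\<close> leaves
  \<open>F 1 * a = 0\<close> with \<open>a\<close> of smaller degree; the descent ends in negative
  degree.\<close>

lemma F1_nonzerodivisor: "homog e h \<Longrightarrow> F 1 * h = 0 \<Longrightarrow> h = 0"
proof (induction "nat (e + 1)" arbitrary: e h rule: less_induct)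
  case less
  show ?case
  proof (cases "e < 0")
    case True
    with less.prems(1) show ?thesis by (rule homog_neg)
  next
    case False
    from less.prems(2) have "F 1 * h = F 0 * 0" by simp
    from reg1_homog[OF less.prems(1) this] obtain a where a: "homog (e - int (d 0)) a" "h = F 0 * a" by blast
    have "F 0 * (F 1 * a) = 0" using less.prems(2) a(2) by (simp add: mult.left_commute)
    then have "F 1 * a = 0" by (rule reg0)
    with less.hyps[OF _ a(1)] pos[of 0] False have "a = 0" by simp
    with a(2) show ?thesis by simp
  qed
qed

text \<open>Modulo \<open>F 0\<close> and \<open>F 1\<close>, regularity puts \<open>h\<close> into
  their ideal. As \<open>e < d 0\<close>, only \<open>h = F 1 * v\<close> is possible, and
  cancelling \<open>F 1\<close> modulo \<open>F 0\<close> gives the same relation for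
  \<open>v\<close>, of smaller degree.\<close>

lemma pair_02: "homog e h \<Longrightarrow> e < int (d 0) \<Longrightarrow> F 2 * h = F 0 * a \<Longrightarrow> h = 0"
proof (induction "nat (e + 1)" arbitrary: e h a rule: less_induct)
  case less
  show ?case
  proof (cases "e < 0")
    case True
    with less.prems(1) show ?thesis by (rule homog_neg)
  next
    case False
    from less.prems(3) have "F 2 * h = F 0 * a + F 1 * 0" by simp
    from reg2_homog[OF less.prems(1) this] obtain u v where
      uv: "homog (e - int (d 0)) u" "homog (e - int (d 1)) v" "h = F 0 * u + F 1 * v" by blast
    have "u = 0" by (rule homog_neg[OF uv(1)]) (use less.prems(2) in simp)
    then have h: "h = F 1 * v" using uv(3) by simp
    have "F 1 * (F 2 * v) = F 0 * a" using less.prems(3) h by (simp add: mult.left_commute)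
    from reg1[OF this] obtain a' where a': "F 2 * v = F 0 * a'" ..
    have "v = 0"
      by (rule less.hyps[OF _ uv(2) _ a']) (use pos[of 1] False less.prems(2) in simp_all)
    with h show ?thesis by simp
  qed
qed

text \<open>Here \<open>e < d 1\<close> leaves \<open>h = F 0 * u\<close>. Then
  \<open>F 1 * a\<close> is a multiple of \<open>F 0\<close>, hence so is \<open>a\<close>, and
  cancelling \<open>F 0\<close> gives the same relation for \<open>u\<close>, of smaller
  degree.\<close>

lemma pair_12: "homog e h \<Longrightarrow> e < int (d 1) \<Longrightarrow> F 2 * h = F 1 * a \<Longrightarrow> h = 0"
proof (induction "nat (e + 1)" arbitrary: e h a rule: less_induct)
  case less
  show ?case
  proof (cases "e < 0")
    case True
    with less.prems(1) show ?thesis by (rule homog_neg)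
  next
    case False
    from less.prems(3) have "F 2 * h = F 0 * 0 + F 1 * a" by simp
    from reg2_homog[OF less.prems(1) this] obtain u v where
      uv: "homog (e - int (d 0)) u" "homog (e - int (d 1)) v" "h = F 0 * u + F 1 * v" by blast
    have "v = 0" by (rule homog_neg[OF uv(2)]) (use less.prems(2) in simp)
    then have h: "h = F 0 * u" using uv(3) by simp
    have "F 1 * a = F 2 * (F 0 * u)" using less.prems(3) unfolding h by (rule sym)
    also have "\<dots> = F 0 * (F 2 * u)" by (rule mult.left_commute)
    finally have e1: "F 1 * a = F 0 * (F 2 * u)" .
    from reg1[OF e1] obtain a' where a': "a = F 0 * a'" ..
    have "F 0 * (F 1 * a') = F 1 * (F 0 * a')" by (rule mult.left_commute)
    also have "\<dots> = F 0 * (F 2 * u)" using e1 unfolding a' .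
    finally have "F 0 * (F 2 * u - F 1 * a') = 0" unfolding right_diff_distrib by (simp only: diff_self)
    from reg0[OF this] have eq: "F 2 * u = F 1 * a'" by simp
    have "u = 0"
      by (rule less.hyps[OF _ uv(1) _ eq]) (use pos[of 0] False less.prems(2) in simp_all)
    with h show ?thesis by simp
  qed
qed

lemma syzygy_pair:
  assumes ij: "i < 3" "j < 3" "i < j"
    and H: "homog (int (d j) - 1) p" "homog (int (d i) - 1) q" "p * F i + q * F j = 0"
  shows "p = 0 \<and> q = 0"
proof -
  have sum0: "F j * q + F i * p = 0"
    using H(3) unfolding mult.commute[of p] mult.commute[of q] by (subst add.commute)
  then have eq: "F j * q = F i * (- p)" unfolding mult_minus_right eq_neg_iff_add_eq_0 .
  have ij_cases: "i = 0 \<and> j = 1 \<or> i = 0 \<and> j = 2 \<or> i = 1 \<and> j = 2" using ij by arith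
  have q: "q = 0"
    using ij_cases
  proof (elim disjE conjE)
    assume ij: "i = 0" "j = 1"
    from reg1_homog[OF H(2) eq[unfolded ij]] obtain a where
      a: "homog (int (d i) - 1 - int (d 0)) a \<and> q = F 0 * a" ..
    have "a = 0" by (rule homog_neg[OF a[THEN conjunct1]]) (simp add: ij)
    with a show ?thesis by simp
  next
    assume ij: "i = 0" "j = 2"
    show ?thesis by (rule pair_02[OF H(2) _ eq[unfolded ij]]) (simp add: ij)
  next
    assume ij: "i = 1" "j = 2"
    show ?thesis by (rule pair_12[OF H(2) _ eq[unfolded ij]]) (simp add: ij)
  qed
  have Fp: "F i * p = 0" using sum0 unfolding q mult_zero_right add_0_left .
  have p: "p = 0"
  proof (cases "i = 0")
    case True
    then show ?thesis using Fp reg0[of p] by simp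
  next
    case False
    then have "i = 1" using ij_cases by blast
    then show ?thesis using Fp F1_nonzerodivisor[OF H(1)] by simp
  qed
  show ?thesis using p q ..
qed

text \<open>Regularity expresses \<open>H 2\<close> through \<open>F 0\<close> and
  \<open>F 1\<close> with cofactors of degrees \<open>n - d 2 - d 0\<close> and
  \<open>n - d 2 - d 1\<close>. Both are negative, so \<open>H 2 = 0\<close>; \<open>H 1\<close> and
  \<open>H 0\<close> follow in the same way.\<close>

lemma syzygy_triple:
  assumes n: "n < d 0 + d 1" "n < d 0 + d 2" "n < d 1 + d 2"
    and H: "\<And>i. i < 3 \<Longrightarrow> homog (int n - int (d i)) (H i)" "H 0 * F 0 + H 1 * F 1 + H 2 * F 2 = 0"
  shows "H 0 = 0 \<and> H 1 = 0 \<and> H 2 = 0"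
proof -
  have "H 2 * F 2 = - (H 0 * F 0 + H 1 * F 1)" using H(2) by (simp add: eq_neg_iff_add_eq_0 algebra_simps)
  then have "F 2 * H 2 = F 0 * (- H 0) + F 1 * (- H 1)" by (simp add: algebra_simps)
  moreover have H2: "homog (int n - int (d 2)) (H 2)" using H(1) by simp
  ultimately obtain u v where uv: "homog (int n - int (d 2) - int (d 0)) u"
    "homog (int n - int (d 2) - int (d 1)) v" "H 2 = F 0 * u + F 1 * v" using reg2_homog by blast
  have "u = 0" by (rule homog_neg[OF uv(1)]) (use n in simp)
  moreover have "v = 0" by (rule homog_neg[OF uv(2)]) (use n in simp)
  ultimately have H2: "H 2 = 0" using uv(3) by simp
  then have "H 1 * F 1 = - (H 0 * F 0)" using H(2) by (simp add: eq_neg_iff_add_eq_0 algebra_simps)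
  then have "F 1 * H 1 = F 0 * (- H 0)" by (simp add: algebra_simps)
  moreover have "homog (int n - int (d 1)) (H 1)" using H(1) by simp
  ultimately obtain w where w: "homog (int n - int (d 1) - int (d 0)) w" "H 1 = F 0 * w"
    using reg1_homog by blast
  have "w = 0" by (rule homog_neg[OF w(1)]) (use n in simp)
  then have H1: "H 1 = 0" using w(2) by simp
  have "F 0 * H 0 = 0" using H(2) H1 H2 by (simp add: mult.commute)
  with H1 H2 show ?thesis using reg0 by blast
qed

text \<open>Cofactors homogenise to degrees \<open>b i\<close>. The hypothesis on \<open>b\<close>
  puts all nonzero terms into the common degree \<open>c\<close>, where dehomogenisation is
  injective, so the relation itself lifts.\<close>

lemma no_global_syzygy_dehomogenize:
  assumes b: "\<And>i. i < 3 \<Longrightarrow> b i = c - int (d i) \<or> b i < 0"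
    and H: "\<And>H. (\<And>i. i < 3 \<Longrightarrow> homog (b i) (H i)) \<Longrightarrow> H 0 * F 0 + H 1 * F 1 + H 2 * F 2 = 0
      \<Longrightarrow> H 0 = 0 \<and> H 1 = 0 \<and> H 2 = 0"
  shows "no_global_syzygy (\<lambda>i. dehomogenize (F i)) b"
  unfolding no_global_syzygy_def
proof (intro allI impI)
  fix G i assume G: "\<forall>i<3. tdeg_le (b i) (G i)" "(\<Sum>i<3. G i * dehomogenize (F i)) = 0" and i: "i < (3::nat)"
  from G(1) homogenize have "\<forall>i\<in>{..<3}. \<exists>p. homog (b i) p \<and> dehomogenize p = G i" by blast
  from bchoice[OF this] obtain H where "\<forall>i\<in>{..<3}. homog (b i) (H i) \<and> dehomogenize (H i) = G i" ..
  then have H': "\<And>i. i < 3 \<Longrightarrow> homog (b i) (H i)" "\<And>i. i < 3 \<Longrightarrow> dehomogenize (H i) = G i" by simp_all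
  have "homog c (H i * F i)" if "i < 3" for i
  proof (cases "b i < 0")
    case True
    then have "H i = 0" using H'(1)[OF that] by (intro homog_neg)
    then show ?thesis by simp
  next
    case False
    with homog_mult[OF H'(1)[OF that] F[OF that]] b[OF that] show ?thesis by simp
  qed
  then have "homog c (\<Sum>i<3. H i * F i)" by (intro homog_sum) simp
  moreover have "dehomogenize (\<Sum>i<3. H i * F i) = 0"
    using G(2) H'(2) by (simp add: dehomogenize_sum dehomogenize_mult)
  ultimately have "(\<Sum>i<3. H i * F i) = 0" by (rule dehomogenize_inj)
  then have "H 0 = 0 \<and> H 1 = 0 \<and> H 2 = 0" by (intro H H'(1)) (simp_all add: sum_less_3)
  then have "\<forall>i<3. H i = 0" unfolding all_less_3 .
  with i H'(2)[OF i] show "G i = 0" by (metis dehomogenize_0)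
qed

lemma no_global_syzygy_pair:
  assumes "i < 3" "j < 3" "i \<noteq> j"
  shows "no_global_syzygy (\<lambda>i. dehomogenize (F i)) (pair_bound d i j)"
proof -
  have lt: "no_global_syzygy (\<lambda>i. dehomogenize (F i)) (pair_bound d i j)" if ij: "i < 3" "j < 3" "i < j" for i j
  proof (rule no_global_syzygy_dehomogenize)
    show "pair_bound d i j l = int (d i) + int (d j) - 1 - int (d l) \<or> pair_bound d i j l < 0" for l
      by (simp add: pair_bound_def)
    fix H assume H: "\<And>l. l < 3 \<Longrightarrow> homog (pair_bound d i j l) (H l)" "H 0 * F 0 + H 1 * F 1 + H 2 * F 2 = 0"
    have other: "H l = 0" if "l < 3" "l \<noteq> i" "l \<noteq> j" for l
      using homog_neg[OF H(1)[OF that(1)]] that by (simp add: pair_bound_def)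
    have "(\<Sum>l<3. H l * F l) = H i * F i + H j * F j"
      by (rule sum_pair[of i j "\<lambda>l. H l * F l"]) (use ij other in auto)
    then have "H i * F i + H j * F j = 0" using H(2) by (simp add: sum_less_3)
    moreover have "homog (int (d j) - 1) (H i)" "homog (int (d i) - 1) (H j)"
      using H(1)[OF ij(1)] H(1)[OF ij(2)] ij(3) by (simp_all add: pair_bound_def)
    ultimately have "H i = 0 \<and> H j = 0" using syzygy_pair[OF ij] by blast
    with other have "\<forall>l<3. H l = 0" by blast
    then show "H 0 = 0 \<and> H 1 = 0 \<and> H 2 = 0" unfolding all_less_3 .
  qed
  have "pair_bound d i j = pair_bound d j i" using assms by (auto simp: pair_bound_def fun_eq_iff)
  with lt[of i j] lt[of j i] assms show ?thesis by (cases "i < j") auto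
qed

lemma no_global_syzygy_triple:
  assumes "\<And>i j. i < 3 \<Longrightarrow> j < 3 \<Longrightarrow> i \<noteq> j \<Longrightarrow> n < d i + d j"
  shows "no_global_syzygy (\<lambda>i. dehomogenize (F i)) (\<lambda>i. int n - int (d i))"
proof (rule no_global_syzygy_dehomogenize[where c = "int n"])
  show "int n - int (d i) = int n - int (d i) \<or> int n - int (d i) < 0" for i by simp
  fix H assume H: "\<And>i. i < 3 \<Longrightarrow> homog (int n - int (d i)) (H i)" "H 0 * F 0 + H 1 * F 1 + H 2 * F 2 = 0"
  have "n < d 0 + d 1" "n < d 0 + d 2" "n < d 1 + d 2"
    using assms[of 0 1] assms[of 0 2] assms[of 1 2] by simp_all
  from syzygy_triple[OF this H] show "H 0 = 0 \<and> H 1 = 0 \<and> H 2 = 0" .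
qed

text \<open>Cofactors of a homogeneous element can be taken homogeneous, which gives the bounds
  after dehomogenising. Conversely, bounded cofactors homogenise, and the difference of the two
  sides vanishes because it is homogeneous of degree \<open>k\<close>.\<close>

lemma in_ideal_iff:
  assumes "homog k u"
  shows "in_ideal (\<lambda>i. dehomogenize (F i)) d k (dehomogenize u) \<longleftrightarrow> (\<exists>h. u = (\<Sum>i<3. h i * F i))"
proof
  assume "\<exists>h. u = (\<Sum>i<3. h i * F i)"
  then obtain h where h: "u = (\<Sum>i<3. h i * F i)" ..
  from homog_combination_F[OF assms h order_refl]
  obtain h' where h': "(\<forall>i. homog (k - int (d i)) (h' i)) \<and> u = (\<Sum>i<3. h' i * F i)" ..
  show "in_ideal (\<lambda>i. dehomogenize (F i)) d k (dehomogenize u)"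
    unfolding in_ideal_def
  proof (intro exI[of _ "\<lambda>i. dehomogenize (h' i)"] conjI allI impI)
    show "tdeg_le (k - int (d i)) (dehomogenize (h' i))" for i
      using h' by (intro tdeg_le_dehomogenize) simp
    show "dehomogenize u = (\<Sum>i<3. dehomogenize (h' i) * dehomogenize (F i))"
      unfolding h'[THEN conjunct2] dehomogenize_sum dehomogenize_mult ..
  qed
next
  assume "in_ideal (\<lambda>i. dehomogenize (F i)) d k (dehomogenize u)"
  then obtain r where r: "\<forall>i<3. tdeg_le (k - int (d i)) (r i)"
    "dehomogenize u = (\<Sum>i<3. r i * dehomogenize (F i))" unfolding in_ideal_def by blast
  from r(1) homogenize have "\<forall>i\<in>{..<3}. \<exists>p. homog (k - int (d i)) p \<and> dehomogenize p = r i" by blast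
  from bchoice[OF this] obtain H where "\<forall>i\<in>{..<3}. homog (k - int (d i)) (H i) \<and> dehomogenize (H i) = r i" ..
  then have H: "\<And>i. i < 3 \<Longrightarrow> homog (k - int (d i)) (H i)" "\<And>i. i < 3 \<Longrightarrow> dehomogenize (H i) = r i" by simp_all
  have "homog k (H i * F i)" if "i < 3" for i
    using homog_mult[OF H(1)[OF that] F[OF that]] by simp
  then have "homog k (\<Sum>i<3. H i * F i)" by (intro homog_sum) simp
  with assms have "homog k (u - (\<Sum>i<3. H i * F i))" by (rule homog_diff)
  moreover have "dehomogenize (u - (\<Sum>i<3. H i * F i)) = 0"
    using H(2) by (simp add: dehomogenize_diff dehomogenize_sum dehomogenize_mult r(2))
  ultimately have "u - (\<Sum>i<3. H i * F i) = 0" by (rule dehomogenize_inj)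
  then have "u = (\<Sum>i<3. H i * F i)" by (simp only: right_minus_eq)
  then show "\<exists>h. u = (\<Sum>i<3. h i * F i)" by (rule exI[of _ H])
qed

end

theorem theorem2p3:
  fixes F1 F2 F3 :: "(3, 'k::{alg_closed_field, field_char_0}) mpoly"
    and d1 d2 d3 :: nat
    and I :: "(3, 'k) mpoly set"
  assumes "homogeneous d1 F1" "homogeneous d2 F2" "homogeneous d3 F3"
    and "d1 > 0" "d2 > 0" "d3 > 0"
    and "regular_sequence mpoly_ring [F1, F2, F3]"
    and "I = Idl\<^bsub>mpoly_ring\<^esub> {F1, F2, F3}"
  shows "weak_lefschetz (mpoly_ring Quot I) (quot_component I)"
proof -
  define F where "F i = [F1, F2, F3] ! i" for i
  define d where "d i = [d1, d2, d3] ! i" for i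
  have F_simps: "F 0 = F1" "F 1 = F2" "F 2 = F3" and d_simps: "d 0 = d1" "d 1 = d2" "d 2 = d3"
    by (simp_all add: F_def d_def)
  have sets: "set (take 0 [F1, F2, F3]) = F ` {..<0}" "set (take 1 [F1, F2, F3]) = F ` {..<1}"
    "set (take 2 [F1, F2, F3]) = F ` {..<2}" and set3: "{F1, F2, F3} = F ` {..<3}"
    by (simp_all add: lessThan_nat_numeral lessThan_Suc F_def insert_commute)
  note reg = regular_sequence_type_algebraD[OF assms(7)]
  interpret homog_regular_3 F d
  proof
    show "homog (int (d i)) (F i)" if "i < 3" for i
    proof -
      have "\<forall>i<3. homog (int (d i)) (F i)"
        unfolding all_less_3 F_simps d_simps using assms(1-3) by (simp add: homogeneous_iff_homog)
      with that show ?thesis by blast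
    qed
    show "0 < d i" if "i < 3" for i
    proof -
      have "\<forall>i<3. 0 < d i" unfolding all_less_3 d_simps using assms(4-6) by simp
      with that show ?thesis by blast
    qed
    show "h = 0" if "F 0 * h = 0" for h
      using reg[of 0 h] that unfolding sets genideal_type_algebra[OF finite_lessThan]
      by (simp add: F_simps)
    show "\<exists>a'. h = F 0 * a'" if "F 1 * h = F 0 * a" for h a
    proof -
      have "[F1, F2, F3] ! 1 * h = (\<Sum>i<1. a * F i)" using that unfolding F_simps by (simp add: F_simps mult.commute)
      then have "[F1, F2, F3] ! 1 * h \<in> Idl\<^bsub>mpoly_ring\<^esub> (set (take 1 [F1, F2, F3]))"
        unfolding sets genideal_type_algebra[OF finite_lessThan] by (intro CollectI exI[of _ "\<lambda>_. a"]) simp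
      from reg[OF _ this] have "h \<in> Idl\<^bsub>mpoly_ring\<^esub> (set (take 1 [F1, F2, F3]))" by simp
      then obtain u where "h = (\<Sum>i<(1::nat). u i * F i)"
        unfolding sets genideal_type_algebra[OF finite_lessThan] by blast
      then show ?thesis by (intro exI[of _ "u 0"]) (simp add: mult.commute)
    qed
    show "\<exists>a' b'. h = F 0 * a' + F 1 * b'" if "F 2 * h = F 0 * a + F 1 * b" for h a b
    proof -
      have sum2: "(\<Sum>i<(2::nat). h i) = h 0 + h 1" for h :: "nat \<Rightarrow> (3, 'k) mpoly"
        by (simp add: eval_nat_numeral)
      have "[F1, F2, F3] ! 2 * h = (\<Sum>i<2. (if i = 0 then a else b) * F i)"
        using that unfolding sum2 F_simps by (simp add: mult.commute)
      then have "[F1, F2, F3] ! 2 * h \<in> Idl\<^bsub>mpoly_ring\<^esub> (set (take 2 [F1, F2, F3]))"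
        unfolding sets genideal_type_algebra[OF finite_lessThan]
        by (intro CollectI exI[of _ "\<lambda>i. if i = 0 then a else b"]) simp
      from reg[OF _ this] have "h \<in> Idl\<^bsub>mpoly_ring\<^esub> (set (take 2 [F1, F2, F3]))" by simp
      then obtain u where "h = (\<Sum>i<(2::nat). u i * F i)"
        unfolding sets genideal_type_algebra[OF finite_lessThan] by blast
      then show ?thesis
        by (intro exI[of _ "u 0"] exI[of _ "u 1"]) (simp add: mult.commute sum2)
    qed
  qed
  interpret ring "mpoly_ring :: (3, 'k) mpoly ring" by (rule ring_from_type_algebra)
  have I: "ideal I mpoly_ring"
    unfolding assms(8) by (rule genideal_ideal) (simp add: type_algebra_simps)
  \<comment> \<open>From here on the claim about cosets is the claim about \<open>inj_at\<close> and
    \<open>surj_at\<close>.\<close>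
  have mem: "u \<in> I \<longleftrightarrow> in_ideal (\<lambda>i. dehomogenize (F i)) d k (dehomogenize u)" if "homog k u" for k u
    unfolding in_ideal_iff[OF that] assms(8) set3 genideal_type_algebra[OF finite_lessThan] by blast
  obtain s t where st: "\<forall>n. inj_at (\<lambda>i. dehomogenize (F i)) d s t (int n) \<or>
      surj_at (\<lambda>i. dehomogenize (F i)) d s t (int n)"
    using wlp_generic_line[of d "\<lambda>i. dehomogenize (F i)", OF tdeg_le_dehomogenize[OF F] pos
        no_global_syzygy_pair no_global_syzygy_triple] by blast
  \<comment> \<open>The equation of the chosen line homogenises to the linear form \<open>l\<close>
    that serves as Lefschetz element.\<close>
  have "tdeg_le 1 (line_form s t)"
    by (simp add: line_form_def tdeg_le_pCons deg_le_pCons one_pCons)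
  then obtain l where l: "homog 1 l" "dehomogenize l = line_form s t" using homogenize by blast
  have comp: "quot_component I n = {I +>\<^bsub>mpoly_ring\<^esub> p |p. homog (int n) p}" for n
    unfolding quot_component_def homogeneous_iff_homog by blast
  show ?thesis
    unfolding weak_lefschetz_def
  proof (intro bexI[of _ "I +>\<^bsub>mpoly_ring\<^esub> l"] allI)
    show "I +>\<^bsub>mpoly_ring\<^esub> l \<in> quot_component I 1" unfolding comp using l(1) by auto
    fix n
    define mul where "mul a = (I +>\<^bsub>mpoly_ring\<^esub> l) \<otimes>\<^bsub>mpoly_ring Quot I\<^esub> a" for a
    have mul: "mul (I +>\<^bsub>mpoly_ring\<^esub> p) = I +>\<^bsub>mpoly_ring\<^esub> (l * p)" for p
      unfolding mul_def by (rule coset_type_algebra_mult[OF I])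
    have l_mult: "homog (int n + 1) (l * p)" if "homog (int n) p" for p
      using homog_mult[OF l(1) that] by (simp add: add.commute)
    have "inj_on mul (quot_component I n)" if inj: "inj_at (\<lambda>i. dehomogenize (F i)) d s t (int n)"
    proof (rule inj_onI)
      fix a b assume "a \<in> quot_component I n" "b \<in> quot_component I n" and eq: "mul a = mul b"
      then obtain p q where pq: "a = I +>\<^bsub>mpoly_ring\<^esub> p" "b = I +>\<^bsub>mpoly_ring\<^esub> q" "homog (int n) p" "homog (int n) q"
        unfolding comp by blast
      have h: "homog (int n) (p - q)" using pq(3,4) by (rule homog_diff)
      have "l * (p - q) \<in> I"
        using eq unfolding pq(1,2) mul coset_type_algebra_eq_iff[OF I] by (simp add: right_diff_distrib)
      then have "in_ideal (\<lambda>i. dehomogenize (F i)) d (int n + 1) (line_form s t * dehomogenize (p - q))"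
        unfolding mem[OF l_mult[OF h]] by (simp add: dehomogenize_mult l(2))
      with inj tdeg_le_dehomogenize[OF h] have "in_ideal (\<lambda>i. dehomogenize (F i)) d (int n) (dehomogenize (p - q))"
        unfolding inj_at_def by blast
      then show "a = b" unfolding pq(1,2) coset_type_algebra_eq_iff[OF I] mem[OF h] .
    qed
    moreover have "mul ` quot_component I n = quot_component I (Suc n)"
      if surj: "surj_at (\<lambda>i. dehomogenize (F i)) d s t (int n)"
    proof
      show "mul ` quot_component I n \<subseteq> quot_component I (Suc n)"
        unfolding comp using mul l_mult by (auto simp: add.commute)
      show "quot_component I (Suc n) \<subseteq> mul ` quot_component I n"
      proof
        fix c assume "c \<in> quot_component I (Suc n)"
        then obtain w where w: "c = I +>\<^bsub>mpoly_ring\<^esub> w" "homog (int n + 1) w"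
          unfolding comp by (auto simp: add.commute)
        from surj tdeg_le_dehomogenize[OF w(2)] obtain v where v: "tdeg_le (int n) v"
          "in_ideal (\<lambda>i. dehomogenize (F i)) d (int n + 1) (dehomogenize w - line_form s t * v)"
          unfolding surj_at_def by blast
        obtain p where p: "homog (int n) p" "dehomogenize p = v" using homogenize[OF v(1)] by blast
        have "homog (int n + 1) (w - l * p)" using w(2) l_mult[OF p(1)] by (rule homog_diff)
        then have "w - l * p \<in> I"
          using v(2) by (simp add: mem dehomogenize_diff dehomogenize_mult l(2) p(2))
        then have "c = mul (I +>\<^bsub>mpoly_ring\<^esub> p)" unfolding w(1) mul coset_type_algebra_eq_iff[OF I] .
        with p(1) show "c \<in> mul ` quot_component I n" unfolding comp by blast
      qed
    qed
    ultimately show "inj_on (\<lambda>a. (I +>\<^bsub>mpoly_ring\<^esub> l) \<otimes>\<^bsub>mpoly_ring Quot I\<^esub> a) (quot_component I n) \<or>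
        (\<lambda>a. (I +>\<^bsub>mpoly_ring\<^esub> l) \<otimes>\<^bsub>mpoly_ring Quot I\<^esub> a) ` quot_component I n = quot_component I (Suc n)"
      using st unfolding mul_def by blast
  qed
qed

end
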